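(* Consider an $N$-agent static team problem such that: (a) for each fixed $x\in\mathsf X$ the map $(\mathbf y,\mathbf u)\mapsto c(x,\mathbf y,\mathbf u)$ is continuous, and $c$ is bounded on every compact subset of $\mathsf X\times\mathsf Y\times\mathsf U$; (b) each $\mathsf U^i$ is a closed and convex subset of a completely metrizable locally convex vector space; (c) each $\mathsf Y^i$ is locally compact; (d) for every compact $G\subset\mathsf U$ of the form $G=\prod_{i=1}^NG^i$, the function $w_G(x,\mathbf y):=\sup_{\mathbf u\in G}c(x,\mathbf y,\mathbf u)$ is integrable with respect to $\mathbb P(dx,d\mathbf y)$; (e) for every $\underline\gamma\in\mathbf\Gamma$ with $J(\underline\gamma)<\infty$ and each $i$, there exists $u^{i,*}\in\mathsf U^i$ such that $J(\underline\gamma^{-i},\gamma^i_{u^{i,*}})<\infty$, where $\gamma^i_{u^{i,*}}\equiv u^{i,*}$ and $(\underline\gamma^{-i},\gamma^i_{u^{i,*}})$ is $\underline\gamma$ with its $i$-th component replaced by $\gamma^i_{u^{i,*}}$. Let $Q_{l,n}^i$ be the observation quantizers described in the context, $\Gamma_{l,n}^i:=\{\gamma^i\circ Q_{l,n}^i:\gamma^i\in\Gamma^i\}$ and $\mathbf\Gamma_{l,n}:=\prod_{i=1}^N\Gamma_{l,n}^i$. Then for any $\varepsilon>0$ there exist a pair $(l,n(l))$ and $\underline\gamma\in\mathbf\Gamma_{l,n(l)}$ such that $$J(\underline\gamma)<J^*+\varepsilon.$$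
   Context: Static team problem: a Borel space is a Borel subset of a complete separable metric space, with its Borel $\sigma$-algebra. $\mathsf X$ is a Borel space with a probability measure $\mathbb P$; for $i=1,\dots,N$ the observation space $\mathsf Y^i$ (with metric $d_i$) and the action space $\mathsf U^i$ are Borel spaces, and $W^i(\cdot|x)$ is a stochastic kernel on $\mathsf Y^i$ given $\mathsf X$. Put $\mathsf Y=\prod_i\mathsf Y^i$, $\mathsf U=\prod_i\mathsf U^i$, and $\mathbb P(dx,d\mathbf y)=\mathbb P(dx)\prod_{i=1}^N W^i(dy^i|x)$. The cost $c:\mathsf X\times\mathsf Y\times\mathsf U\to[0,\infty)$ is Borel measurable. $\Gamma^i$ is the set of measurable maps $\gamma^i:\mathsf Y^i\to\mathsf U^i$, $\mathbf\Gamma=\prod_i\Gamma^i$, $\underline\gamma(\mathbf y)=(\gamma^1(y^1),\dots,\gamma^N(y^N))$, $J(\underline\gamma)=\int c(x,\mathbf y,\underline\gamma(\mathbf y))\,\mathbb P(dx,d\mathbf y)\in[0,\infty]$ and $J^*=\inf_{\underline\gamma\in\mathbf\Gamma}J(\underline\gamma)$. Quantizers: for each $i$, $(\mathsf K_l^i)_{l\ge1}$ is a sequence of compact sets with $\mathsf K_l^i\subset\operatorname{int}\mathsf K_{l+1}^i$ and $\mathsf Y^i=\bigcup_l\mathsf K_l^i$. For each $l,n\ge1$, $\mathsf Y_{l,n}^i\subset\mathsf K_l^i$ is a finite $1/n$-net in $\mathsf K_l^i$ (i.e. $\min_{z\in\mathsf Y_{l,n}^i}d_i(y,z)<1/n$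 for all $y\in\mathsf K_l^i$), and $q_{l,n}^i:\mathsf K_l^i\to\mathsf Y_{l,n}^i$, $q_{l,n}^i(y)=\arg\min_{z\in\mathsf Y_{l,n}^i}d_i(y,z)$ with ties broken measurably. Fix $y_{i,0}\in\mathsf Y^i$; $Q_{l,n}^i:\mathsf Y^i\to\mathsf Y^i$ equals $q_{l,n}^i(y)$ for $y\in\mathsf K_l^i$ and $y_{i,0}$ for $y\notin\mathsf K_l^i$. *)

theory Defs
  imports "HOL-Probability.Probability"
begin

section \<open>Borel spaces and locally convex spaces\<close>

definition borel_of :: "'a topology \<Rightarrow> 'a measure" where
  "borel_of T = sigma (topspace T) {A. openin T A}"

lemma space_borel_of [simp]: "space (borel_of T) = topspace T"
  unfolding borel_of_def by (intro space_measure_of) (auto dest: openin_subset)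

lemma sets_borel_of: "sets (borel_of T) = sigma_sets (topspace T) {A. openin T A}"
  unfolding borel_of_def by (intro sets_measure_of) (auto dest: openin_subset)

text \<open>
  A topological space is a Borel space if it is a Borel subset, with the relative topology, of a
  complete separable metric space. Spaces are carriers inside a type, so the ambient metric space
  \<open>m\<close> may be larger than \<open>topspace T\<close>.
\<close>

definition borel_space :: "'a topology \<Rightarrow> bool" where
  "borel_space T \<longleftrightarrow>
     (\<exists>m. mcomplete_of m \<and> separable_space (mtopology_of m)
        \<and> topspace T \<in> sets (borel_of (mtopology_of m))
        \<and> T = subtopology (mtopology_of m) (topspace T))"

text \<open>
  The vector space is the linear subspace \<open>topspace V\<close> of the ambient type, so that a family of
  unrelated vector spaces can be treated inside one type.
\<close>

definition locally_convex_vector_space :: "'v::real_vector topology \<Rightarrow> bool" where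
  "locally_convex_vector_space V \<longleftrightarrow>
     subspace (topspace V)
   \<and> continuous_map (prod_topology V V) V (\<lambda>(a, b). a + b)
   \<and> continuous_map (prod_topology euclideanreal V) V (\<lambda>(r, a). r *\<^sub>R a)
   \<and> (\<forall>A. openin V A \<and> 0 \<in> A \<longrightarrow> (\<exists>C. openin V C \<and> convex C \<and> 0 \<in> C \<and> C \<subseteq> A))"

section \<open>Static team problems\<close>

text \<open>
  The agents are \<open>1, \<dots>, N\<close>. The space \<open>\<Prod>\<^sub>i Y\<^sup>i\<close> consists of the functions on the agents that are
  extensional outside \<open>{1..N}\<close>. The topology of \<open>Y\<^sup>i\<close> is the one of its metric, which need not be
  complete.
\<close>

definition obs_top :: "nat \<Rightarrow> (nat \<Rightarrow> 'y metric) \<Rightarrow> (nat \<Rightarrow> 'y) topology" where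
  "obs_top N Y = product_topology (\<lambda>i. mtopology_of (Y i)) {1..N}"

definition act_top :: "nat \<Rightarrow> (nat \<Rightarrow> 'u topology) \<Rightarrow> (nat \<Rightarrow> 'u) topology" where
  "act_top N U = product_topology U {1..N}"

definition obs_algebra :: "nat \<Rightarrow> (nat \<Rightarrow> 'y metric) \<Rightarrow> (nat \<Rightarrow> 'y) measure" where
  "obs_algebra N Y = (\<Pi>\<^sub>M i\<in>{1..N}. borel_of (mtopology_of (Y i)))"

text \<open>The measure \<open>P(dx) \<Prod>\<^sub>i W\<^sup>i(dy\<^sup>i | x)\<close>.\<close>

definition joint_law ::
  "nat \<Rightarrow> 'x topology \<Rightarrow> (nat \<Rightarrow> 'y metric) \<Rightarrow> 'x measure \<Rightarrow> (nat \<Rightarrow> 'x \<Rightarrow> 'y measure)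
    \<Rightarrow> ('x \<times> (nat \<Rightarrow> 'y)) measure" where
  "joint_law N X Y P W =
     P \<bind> (\<lambda>x. distr (\<Pi>\<^sub>M i\<in>{1..N}. W i x) (borel_of X \<Otimes>\<^sub>M obs_algebra N Y) (\<lambda>y. (x, y)))"

definition policies :: "'y metric \<Rightarrow> 'u topology \<Rightarrow> ('y \<Rightarrow> 'u) set" where
  "policies Yi Ui = borel_of (mtopology_of Yi) \<rightarrow>\<^sub>M borel_of Ui"

definition team_policies ::
  "nat \<Rightarrow> (nat \<Rightarrow> 'y metric) \<Rightarrow> (nat \<Rightarrow> 'u topology) \<Rightarrow> (nat \<Rightarrow> 'y \<Rightarrow> 'u) set" where
  "team_policies N Y U = (\<Pi> i\<in>{1..N}. policies (Y i) (U i))"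

definition team_action :: "nat \<Rightarrow> (nat \<Rightarrow> 'y \<Rightarrow> 'u) \<Rightarrow> (nat \<Rightarrow> 'y) \<Rightarrow> (nat \<Rightarrow> 'u)" where
  "team_action N \<gamma> y = (\<lambda>i\<in>{1..N}. \<gamma> i (y i))"

definition team_cost ::
  "nat \<Rightarrow> 'x topology \<Rightarrow> (nat \<Rightarrow> 'y metric) \<Rightarrow> 'x measure \<Rightarrow> (nat \<Rightarrow> 'x \<Rightarrow> 'y measure)
    \<Rightarrow> ('x \<Rightarrow> (nat \<Rightarrow> 'y) \<Rightarrow> (nat \<Rightarrow> 'u) \<Rightarrow> real) \<Rightarrow> (nat \<Rightarrow> 'y \<Rightarrow> 'u) \<Rightarrow> ennreal" where
  "team_cost N X Y P W c \<gamma> =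
     (\<integral>\<^sup>+ (x, y). ennreal (c x y (team_action N \<gamma> y)) \<partial>joint_law N X Y P W)"

definition optimal_cost ::
  "nat \<Rightarrow> 'x topology \<Rightarrow> (nat \<Rightarrow> 'y metric) \<Rightarrow> (nat \<Rightarrow> 'u topology) \<Rightarrow> 'x measure
    \<Rightarrow> (nat \<Rightarrow> 'x \<Rightarrow> 'y measure) \<Rightarrow> ('x \<Rightarrow> (nat \<Rightarrow> 'y) \<Rightarrow> (nat \<Rightarrow> 'u) \<Rightarrow> real) \<Rightarrow> ennreal" where
  "optimal_cost N X Y U P W c = (INF \<gamma>\<in>team_policies N Y U. team_cost N X Y P W c \<gamma>)"

definition static_team ::
  "nat \<Rightarrow> 'x topology \<Rightarrow> (nat \<Rightarrow> 'y metric) \<Rightarrow> (nat \<Rightarrow> 'u topology) \<Rightarrow> 'x measure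
    \<Rightarrow> (nat \<Rightarrow> 'x \<Rightarrow> 'y measure) \<Rightarrow> ('x \<Rightarrow> (nat \<Rightarrow> 'y) \<Rightarrow> (nat \<Rightarrow> 'u) \<Rightarrow> real) \<Rightarrow> bool" where
  "static_team N X Y U P W c \<longleftrightarrow>
     1 \<le> N \<and> borel_space X \<and> prob_space P \<and> sets P = sets (borel_of X)
   \<and> (\<forall>i\<in>{1..N}. borel_space (mtopology_of (Y i)))
   \<and> (\<forall>i\<in>{1..N}. borel_space (U i) \<and> topspace (U i) \<noteq> {})
   \<and> (\<forall>i\<in>{1..N}. W i \<in> borel_of X \<rightarrow>\<^sub>M prob_algebra (borel_of (mtopology_of (Y i))))
   \<and> (\<lambda>(x, y, u). c x y u) \<in>
        borel_measurable (borel_of (prod_topology X (prod_topology (obs_top N Y) (act_top N U))))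
   \<and> (\<forall>x\<in>topspace X. \<forall>y\<in>topspace (obs_top N Y). \<forall>u\<in>topspace (act_top N U). 0 \<le> c x y u)"

section \<open>Observation quantizers\<close>

definition compact_exhaustion :: "'y metric \<Rightarrow> (nat \<Rightarrow> 'y set) \<Rightarrow> bool" where
  "compact_exhaustion Yi K \<longleftrightarrow>
     (\<forall>l\<ge>1. compactin (mtopology_of Yi) (K l)
           \<and> K l \<subseteq> mtopology_of Yi interior_of K (Suc l))
   \<and> mspace Yi = (\<Union>l\<in>{1..}. K l)"

definition finite_net :: "'y metric \<Rightarrow> 'y set \<Rightarrow> real \<Rightarrow> 'y set \<Rightarrow> bool" where
  "finite_net Yi K r Z \<longleftrightarrow> finite Z \<and> Z \<subseteq> K \<and> (\<forall>y\<in>K. \<exists>z\<in>Z. mdist Yi y z < r)"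

definition nearest_neighbour_map :: "'y metric \<Rightarrow> 'y set \<Rightarrow> 'y set \<Rightarrow> ('y \<Rightarrow> 'y) \<Rightarrow> bool" where
  "nearest_neighbour_map Yi K Z q \<longleftrightarrow>
     q \<in> restrict_space (borel_of (mtopology_of Yi)) K \<rightarrow>\<^sub>M borel_of (mtopology_of Yi)
   \<and> (\<forall>y\<in>K. is_arg_min (mdist Yi y) (\<lambda>z. z \<in> Z) (q y))"

definition extend_quantizer :: "'y set \<Rightarrow> ('y \<Rightarrow> 'y) \<Rightarrow> 'y \<Rightarrow> 'y \<Rightarrow> 'y" where
  "extend_quantizer K q y0 y = (if y \<in> K then q y else y0)"

definition quantized_team_policies ::
  "nat \<Rightarrow> (nat \<Rightarrow> 'y metric) \<Rightarrow> (nat \<Rightarrow> 'u topology) \<Rightarrow> (nat \<Rightarrow> 'y \<Rightarrow> 'y)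
    \<Rightarrow> (nat \<Rightarrow> 'y \<Rightarrow> 'u) set" where
  "quantized_team_policies N Y U Q = (\<Pi> i\<in>{1..N}. {g \<circ> Q i |g. g \<in> policies (Y i) (U i)})"

end

theory Submission
  imports Defs
begin

text \<open>
  Start from a policy with cost below \<open>J\<^sup>* + \<epsilon>\<close>. By Lusin's theorem, applied to the image on \<open>Y\<^sup>i\<close>
  of the finite measure with density \<open>c\<close> along the policy with \<open>i\<close>-th component \<open>u\<^sup>i\<^sup>,\<^sup>*\<close>, the map
  \<open>\<gamma>\<^sup>i\<close> is continuous on a compact set \<open>C\<close> off which the constant \<open>u\<^sup>i\<^sup>,\<^sup>*\<close> costs almost nothing.
  Using \<open>u\<^sup>i\<^sup>,\<^sup>*\<close> off \<open>C\<close>, agent after agent, gives a policy with values in a compact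
  product \<open>G\<close>, whose cost is dominated by the integrable \<open>w\<^sub>G\<close>. A second use of Lusin's theorem, now
  for the density \<open>w\<^sub>G\<close>, gives compact sets \<open>C\<^sup>i\<close>, contained in some \<open>K\<^sub>l\<^sup>i\<close>. Send a net point
  \<open>z\<close> to the value of \<open>\<gamma>\<^sup>i\<close> at a point of \<open>C\<^sup>i\<close> within \<open>1/n\<close> of \<open>z\<close>. These quantized policies take
  values in \<open>G\<close> and converge to \<open>\<gamma>\<close> wherever \<open>y\<^sup>i \<in> C\<^sup>i\<close> for all \<open>i\<close>: dominated convergence applies
  there, and elsewhere the integral of \<open>w\<^sub>G\<close> is small.
\<close>

section \<open>Borel sets of second countable topologies\<close>

text \<open>\<open>second_countable\<close> with the base as a parameter, so that bases of products
  can be written down and measurability can be tested on their members.\<close>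

definition countable_base :: "'a set set \<Rightarrow> 'a topology \<Rightarrow> bool" where
  "countable_base \<B> T \<longleftrightarrow> countable \<B> \<and> (\<forall>V\<in>\<B>. openin T V)
     \<and> (\<forall>G x. openin T G \<and> x \<in> G \<longrightarrow> (\<exists>V\<in>\<B>. x \<in> V \<and> V \<subseteq> G))"

lemma second_countable_iff_countable_base: "second_countable T \<longleftrightarrow> (\<exists>\<B>. countable_base \<B> T)"
  unfolding second_countable_def countable_base_def ..

lemma countable_base_prod:
  assumes "countable_base \<A> S" "countable_base \<B> T"
  shows "countable_base ((\<lambda>(A, B). A \<times> B) ` (\<A> \<times> \<B>)) (prod_topology S T)"
  unfolding countable_base_def
proof (intro conjI allI impI; (elim conjE)?)
  show "countable ((\<lambda>(A, B). A \<times> B) ` (\<A> \<times> \<B>))"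
    using assms by (auto simp: countable_base_def)
  show "\<forall>V\<in>(\<lambda>(A, B). A \<times> B) ` (\<A> \<times> \<B>). openin (prod_topology S T) V"
    using assms by (auto simp: countable_base_def openin_prod_Times_iff)
  fix G x assume G: "openin (prod_topology S T) G" and x: "x \<in> G"
  obtain U V where UV: "openin S U" "openin T V" "fst x \<in> U" "snd x \<in> V" "U \<times> V \<subseteq> G"
    using G x openin_prod_topology_alt[of S T G] by (cases x) force
  obtain A where "A \<in> \<A>" "fst x \<in> A" "A \<subseteq> U"
    using assms(1) UV unfolding countable_base_def by blast
  moreover obtain B where "B \<in> \<B>" "snd x \<in> B" "B \<subseteq> V"
    using assms(2) UV unfolding countable_base_def by blast
  ultimately show "\<exists>W\<in>(\<lambda>(A, B). A \<times> B) ` (\<A> \<times> \<B>). x \<in> W \<and> W \<subseteq> G"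
    using UV by (intro bexI[of _ "A \<times> B"]) (auto simp: mem_Times_iff)
qed

text \<open>The base consists of the boxes with sides from the given bases. Finiteness of
  \<open>I\<close> serves twice: it makes the family of boxes countable and every box open.\<close>

lemma countable_base_product:
  assumes I: "finite I" and \<B>: "\<And>i. i \<in> I \<Longrightarrow> countable_base (\<B> i) (T i)"
  shows "countable_base (PiE I ` PiE I \<B>) (product_topology T I)"
  unfolding countable_base_def
proof (intro conjI allI impI; (elim conjE)?)
  show "countable (PiE I ` PiE I \<B>)"
    using assms by (auto simp: countable_base_def intro!: countable_image countable_PiE)
  show "\<forall>V\<in>PiE I ` PiE I \<B>. openin (product_topology T I) V"
    using assms by (auto simp: countable_base_def openin_PiE PiE_iff)
  fix G x assume G: "openin (product_topology T I) G" and x: "x \<in> G"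
  obtain U where U: "\<And>i. i \<in> I \<Longrightarrow> openin (T i) (U i)" "x \<in> PiE I U" "PiE I U \<subseteq> G"
    using iffD1[OF openin_product_topology_alt G, THEN bspec, OF x] by metis
  have "\<forall>i\<in>I. \<exists>B. B \<in> \<B> i \<and> x i \<in> B \<and> B \<subseteq> U i"
  proof
    fix i assume i: "i \<in> I"
    then have "x i \<in> U i" using U(2) by auto
    then show "\<exists>B. B \<in> \<B> i \<and> x i \<in> B \<and> B \<subseteq> U i"
      using \<B>[OF i] U(1)[OF i] unfolding countable_base_def by blast
  qed
  then obtain B where B: "\<And>i. i \<in> I \<Longrightarrow> B i \<in> \<B> i \<and> x i \<in> B i \<and> B i \<subseteq> U i"
    by metis
  \<comment> \<open>The restriction makes the choice of sides extensional, hence a member of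
    \<open>PiE I \<B>\<close>, and leaves the box unchanged.\<close>
  have "PiE I (restrict B I) \<in> PiE I ` PiE I \<B>"
    using B by (intro imageI) auto
  moreover have "x \<in> PiE I (restrict B I)"
    using U B by (auto simp: PiE_iff)
  moreover have "PiE I (restrict B I) \<subseteq> G"
    using U(3) B PiE_mono[of I "restrict B I" U] by auto
  ultimately show "\<exists>W\<in>PiE I ` PiE I \<B>. x \<in> W \<and> W \<subseteq> G"
    by blast
qed

section \<open>Measurability into Borel algebras of products\<close>

lemma open_in_sets_borel_of: "openin T A \<Longrightarrow> A \<in> sets (borel_of T)"
  by (auto simp: sets_borel_of)

lemma closed_in_sets_borel_of: "closedin T A \<Longrightarrow> A \<in> sets (borel_of T)"
  using sets.compl_sets[OF open_in_sets_borel_of, of T "topspace T - A"]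
  by (simp add: closedin_def double_diff)

text \<open>An open set is the union of the countably many base members inside it, so preimages of
  base members decide measurability.\<close>

lemma measurable_borel_ofI:
  assumes "countable_base \<B> T" and "f \<in> space M \<rightarrow> topspace T"
    and "\<And>B. B \<in> \<B> \<Longrightarrow> f -` B \<inter> space M \<in> sets M"
  shows "f \<in> M \<rightarrow>\<^sub>M borel_of T"
  unfolding borel_of_def
proof (rule measurable_measure_of)
  show "{A. openin T A} \<subseteq> Pow (topspace T)"
    by (auto dest: openin_subset)
  fix G assume "G \<in> {A. openin T A}"
  then have G: "openin T G" by simp
  have "f -` G \<inter> space M = (\<Union>B\<in>{B\<in>\<B>. B \<subseteq> G}. f -` B \<inter> space M)"
    using G assms(1) unfolding countable_base_def by blast
  moreover have "\<dots> \<in> sets M"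
    using assms by (intro sets.countable_UN'') (auto simp: countable_base_def)
  ultimately show "f -` G \<inter> space M \<in> sets M" by simp
qed (use assms in auto)

lemma measurable_borel_of_Pair:
  assumes "second_countable S" "second_countable T"
    and f: "f \<in> M \<rightarrow>\<^sub>M borel_of S" and g: "g \<in> M \<rightarrow>\<^sub>M borel_of T"
  shows "(\<lambda>x. (f x, g x)) \<in> M \<rightarrow>\<^sub>M borel_of (prod_topology S T)"
proof -
  obtain \<A> \<B> where \<A>: "countable_base \<A> S" and \<B>: "countable_base \<B> T"
    using assms by (auto simp: second_countable_iff_countable_base)
  show ?thesis
  proof (rule measurable_borel_ofI[OF countable_base_prod[OF \<A> \<B>]])
    show "(\<lambda>x. (f x, g x)) \<in> space M \<rightarrow> topspace (prod_topology S T)"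
      using measurable_space[OF f] measurable_space[OF g] by auto
    fix W assume "W \<in> (\<lambda>(A, B). A \<times> B) ` (\<A> \<times> \<B>)"
    then obtain A B where W: "W = A \<times> B" "A \<in> \<A>" "B \<in> \<B>" by auto
    then have "A \<in> sets (borel_of S)" "B \<in> sets (borel_of T)"
      using \<A> \<B> by (auto simp: countable_base_def open_in_sets_borel_of)
    then have "(f -` A \<inter> space M) \<inter> (g -` B \<inter> space M) \<in> sets M"
      using f g by (intro sets.Int measurable_sets)
    moreover have "(\<lambda>x. (f x, g x)) -` W \<inter> space M = (f -` A \<inter> space M) \<inter> (g -` B \<inter> space M)"
      using W by auto
    ultimately show "(\<lambda>x. (f x, g x)) -` W \<inter> space M \<in> sets M" by simp
  qed
qed

text \<open>Bridge from the product of Borel algebras to the Borel algebra of the product topology: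
  the preimage of a box is a finite intersection of preimages of its sides.\<close>

lemma measurable_borel_of_product:
  assumes I: "finite I" and T: "\<And>i. i \<in> I \<Longrightarrow> second_countable (T i)"
    and f: "\<And>i. i \<in> I \<Longrightarrow> (\<lambda>x. f x i) \<in> M \<rightarrow>\<^sub>M borel_of (T i)"
    and ext: "\<And>x. x \<in> space M \<Longrightarrow> f x \<in> extensional I"
  shows "f \<in> M \<rightarrow>\<^sub>M borel_of (product_topology T I)"
proof -
  obtain \<B> where \<B>: "\<And>i. i \<in> I \<Longrightarrow> countable_base (\<B> i) (T i)"
    using T unfolding second_countable_iff_countable_base by metis
  show ?thesis
  proof (rule measurable_borel_ofI[OF countable_base_product[OF I \<B>]])
    show "f \<in> space M \<rightarrow> topspace (product_topology T I)"
      using measurable_space[OF f] ext by (auto simp: PiE_iff)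
    fix W assume "W \<in> PiE I ` PiE I \<B>"
    then obtain B where W: "W = PiE I B" "\<And>i. i \<in> I \<Longrightarrow> B i \<in> \<B> i" by auto
    then have "B i \<in> sets (borel_of (T i))" if "i \<in> I" for i
      using \<B> that by (auto simp: countable_base_def open_in_sets_borel_of)
    then have m: "{x \<in> space M. f x i \<in> B i} \<in> sets M" if "i \<in> I" for i
      using measurable_sets[OF f[OF that]] that by (simp add: vimage_def Int_def conj_commute)
    have "{x \<in> space M. \<forall>i\<in>I. f x i \<in> B i} \<in> sets M"
      using m I by (intro sets.sets_Collect_finite_All)
    moreover have "f -` W \<inter> space M = {x \<in> space M. \<forall>i\<in>I. f x i \<in> B i}"
      using W ext by (auto simp: PiE_iff)
    ultimately show "f -` W \<inter> space M \<in> sets M" by simp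
  qed
qed

lemma second_countable_prod_topology:
  "second_countable S \<Longrightarrow> second_countable T \<Longrightarrow> second_countable (prod_topology S T)"
  unfolding second_countable_iff_countable_base by (blast intro: countable_base_prod)

lemma second_countable_product_topology:
  assumes "finite I" "\<And>i. i \<in> I \<Longrightarrow> second_countable (T i)"
  shows "second_countable (product_topology T I)"
proof -
  obtain \<B> where "\<And>i. i \<in> I \<Longrightarrow> countable_base (\<B> i) (T i)"
    using assms(2) unfolding second_countable_iff_countable_base by metis
  then show ?thesis
    using countable_base_product[OF assms(1)] unfolding second_countable_iff_countable_base by blast
qed

lemma second_countable_mtopology_of:
  assumes "separable_space (mtopology_of m)"
  shows "second_countable (mtopology_of m)"
proof -
  interpret Metric_space "mspace m" "mdist m" by simp
  obtain C where C: "countable C" "C \<subseteq> mspace m" "mtopology closure_of C = mspace m"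
    using assms by (auto simp: separable_space_def mtopology_of_def)
  define \<B> where "\<B> = (\<lambda>(x, n). mball x (1 / real (Suc n))) ` (C \<times> UNIV)"
  have "\<exists>V\<in>\<B>. x \<in> V \<and> V \<subseteq> G" if G: "openin mtopology G" and x: "x \<in> G" for G x
  proof -
    obtain r where r: "r > 0" "mball x r \<subseteq> G"
      using G x unfolding openin_mtopology by blast
    have xm: "x \<in> mspace m"
      using G x unfolding openin_mtopology by blast
    \<comment> \<open>A ball of radius below \<open>r / 2\<close> that contains \<open>x\<close>
      stays inside \<open>mball x r\<close>, wherever its centre in the dense set lies.\<close>
    obtain n where n: "1 / real (Suc n) < r / 2"
      using r nat_approx_posE[of "r/2"] by auto
    obtain z where z: "z \<in> C" "z \<in> mball x (1 / real (Suc n))"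
    proof -
      have "0 < 1 / real (Suc n)" by simp
      moreover have "x \<in> mtopology closure_of C" using xm C by simp
      ultimately show ?thesis
        unfolding metric_closure_of using that by blast
    qed
    have "x \<in> mball z (1 / real (Suc n))"
      using z by (auto simp: commute)
    moreover have "mball z (1 / real (Suc n)) \<subseteq> mball x r"
    proof
      fix y assume y: "y \<in> mball z (1 / real (Suc n))"
      then have "mdist m x y \<le> mdist m x z + mdist m z y"
        using z xm by (intro triangle) auto
      then show "y \<in> mball x r"
        using y z n xm by auto
    qed
    moreover have "mball z (1 / real (Suc n)) \<in> \<B>"
      using z by (auto simp: \<B>_def)
    ultimately show ?thesis using r by blast
  qed
  then have "countable_base \<B> (mtopology_of m)"
    using C by (auto simp: countable_base_def \<B>_def mtopology_of_def)
  then show ?thesis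
    by (auto simp: second_countable_iff_countable_base)
qed

lemma borel_space_second_countable: "borel_space T \<Longrightarrow> second_countable T"
  unfolding borel_space_def by (metis second_countable_mtopology_of second_countable_subtopology)

section \<open>Regularity and Lusin's theorem\<close>

text \<open>The bounds sum to \<open>e / 2\<close>. The other half of \<open>e\<close> is left for
  the second error in each application: truncating a union in the regularity lemma, cutting to a
  compact set in Lusin's theorem.\<close>

lemma (in finite_measure) measure_UN_geometric_le:
  assumes D: "\<And>n. D n \<in> sets M" and less: "\<And>n. measure M (D n) < e / 4 * (1 / 2) ^ n"
  shows "measure M (\<Union>n. D n) \<le> e / 2"
proof -
  have sums: "(\<lambda>n. e / 4 * (1 / 2) ^ n) sums (e / 2)"
    using sums_mult[OF geometric_sums[of "1/2::real"], of "e/4"] by simp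
  have sm: "summable (\<lambda>n. measure M (D n))"
    using less sums by (intro summable_comparison_test'[of _ 0, OF sums_summable[OF sums]])
      (auto intro: less_imp_le)
  have "measure M (\<Union>n. D n) \<le> (\<Sum>n. measure M (D n))"
    using D sm by (intro finite_measure_subadditive_countably) auto
  also have "\<dots> \<le> (\<Sum>n. e / 4 * (1 / 2) ^ n)"
    using less sm sums by (intro suminf_le) (auto intro: less_imp_le sums_summable)
  also have "\<dots> = e / 2" using sums by (simp add: sums_iff)
  finally show ?thesis .
qed

text \<open>The sets with such sandwiches form a sigma-algebra containing the open sets. In a
  metrizable space an open set is an increasing union of closed sets, and complementation exchanges
  the two bounds without changing \<open>V - F\<close>.\<close>

lemma closed_open_regularity:
  assumes "finite_measure M" and sets: "sets M = sets (borel_of T)" and T: "metrizable_space T"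
    and "A \<in> sets M" "0 < e"
  shows "\<exists>F V. closedin T F \<and> openin T V \<and> F \<subseteq> A \<and> A \<subseteq> V \<and> measure M (V - F) < e"
proof -
  interpret finite_measure M by fact
  have op: "V \<in> sets M" if "openin T V" for V
    using that sets by (simp add: open_in_sets_borel_of)
  have cl: "V \<in> sets M" if "closedin T V" for V
    using that sets by (simp add: closed_in_sets_borel_of)
  have "A \<in> sigma_sets (topspace T) {A. openin T A}"
    using assms by (simp add: sets_borel_of)
  then show ?thesis using \<open>0 < e\<close>
  proof (induction arbitrary: e)
    case (Basic A)
    then have A: "openin T A" by simp
    then obtain C where C: "\<And>n. closedin T (C n)" "incseq C" "(\<Union>n. C n) = A"
      using open_imp_fsigma_in[OF T] by (metis fsigma_in_ascending incseq_SucI)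
    have "(\<lambda>n. measure M (C n)) \<longlonglongrightarrow> measure M (\<Union>n. C n)"
      using C cl by (intro finite_Lim_measure_incseq) auto
    then have "\<forall>\<^sub>F n in sequentially. measure M A - e < measure M (C n)"
      using C \<open>0 < e\<close> by (intro order_tendstoD) auto
    then obtain n where n: "measure M A - e < measure M (C n)"
      by (auto simp: eventually_sequentially)
    have "C n \<subseteq> A" using C by auto
    moreover have "measure M (A - C n) = measure M A - measure M (C n)"
      using calculation cl C op A by (intro finite_measure_Diff) auto
    ultimately show ?case using A C n by (intro exI[of _ "C n"] exI[of _ A]) auto
  next
    case Empty
    then show ?case by (intro exI[of _ "{}"]) auto
  next
    case (Compl A)
    then obtain F V where FV: "closedin T F" "openin T V" "F \<subseteq> A" "A \<subseteq> V" "measure M (V - F) < e"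
      using Compl.IH[OF Compl.prems] by (elim exE conjE)
    have "(topspace T - F) - (topspace T - V) = V - F"
      using FV openin_subset by blast
    then show ?case
      using FV by (intro exI[of _ "topspace T - V"] exI[of _ "topspace T - F"]) auto
  next
    case (Union A)
    have "\<exists>F V. closedin T F \<and> openin T V \<and> F \<subseteq> A n \<and> A n \<subseteq> V
            \<and> measure M (V - F) < e / 4 * (1 / 2) ^ n" for n
      using Union by (intro Union.IH) auto
    then obtain F V where FV: "\<And>n. closedin T (F n)" "\<And>n. openin T (V n)" "\<And>n. F n \<subseteq> A n"
        "\<And>n. A n \<subseteq> V n" "\<And>n. measure M (V n - F n) < e / 4 * (1 / 2) ^ n"
      by metis
    have Fm: "F n \<in> sets M" and Vm: "V n \<in> sets M" for n
      using FV op cl by auto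
    have 1: "measure M (\<Union>n. V n - F n) \<le> e / 2"
      using Fm Vm FV(5) by (intro measure_UN_geometric_le) auto
    \<comment> \<open>An infinite union of closed sets need not be closed, so finitely many
      \<open>F k\<close> are kept. By continuity from below the discarded rest has measure less than
      \<open>e / 2\<close>.\<close>
    define H where "H n = (\<Union>k\<le>n. F k)" for n
    have Hc: "closedin T (H n)" for n
      unfolding H_def using FV by (intro closedin_Union) auto
    have HU: "(\<Union>n. H n) = (\<Union>n. F n)" by (auto simp: H_def)
    have "incseq H" by (auto simp: H_def incseq_def intro: order_trans)
    then have "(\<lambda>n. measure M (H n)) \<longlonglongrightarrow> measure M (\<Union>n. H n)"
      using Hc cl by (intro finite_Lim_measure_incseq) auto
    then have "\<forall>\<^sub>F n in sequentially. measure M (\<Union>n. F n) - e / 2 < measure M (H n)"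
      using HU Union.prems by (intro order_tendstoD) auto
    then obtain n where n: "measure M (\<Union>n. F n) - e / 2 < measure M (H n)"
      by (auto simp: eventually_sequentially)
    have "measure M ((\<Union>n. F n) - H n) = measure M (\<Union>n. F n) - measure M (H n)"
      using cl Hc Fm HU by (intro finite_measure_Diff) auto
    then have 2: "measure M ((\<Union>n. F n) - H n) < e / 2" using n by simp
    have "measure M ((\<Union>n. V n) - H n) \<le> measure M ((\<Union>n. V n - F n) \<union> ((\<Union>n. F n) - H n))"
      using Fm Vm cl[OF Hc] by (intro finite_measure_mono) auto
    also have "\<dots> \<le> measure M (\<Union>n. V n - F n) + measure M ((\<Union>n. F n) - H n)"
      using Fm Vm cl[OF Hc] by (intro measure_Un_le) auto
    also have "\<dots> < e" using 1 2 by simp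
    finally have "measure M ((\<Union>n. V n) - H n) < e" .
    moreover have "openin T (\<Union>n. V n)" using FV by auto
    moreover have "H n \<subseteq> (\<Union>n. A n)" unfolding H_def using FV(3) by blast
    moreover have "(\<Union>n. A n) \<subseteq> (\<Union>n. V n)" using FV(4) by blast
    ultimately show ?case using Hc[of n]
      by (intro exI[of _ "H n"] exI[of _ "\<Union>n. V n"] conjI)
  qed
qed

section \<open>Compact exhaustions\<close>

lemma compact_exhaustion_mono:
  assumes "compact_exhaustion m K" "1 \<le> k" "k \<le> l"
  shows "K k \<subseteq> K l"
  using \<open>k \<le> l\<close>
proof (induction rule: dec_induct)
  case (step n)
  then have "K n \<subseteq> mtopology_of m interior_of K (Suc n)"
    using assms unfolding compact_exhaustion_def by auto
  also have "\<dots> \<subseteq> K (Suc n)" by (rule interior_of_subset)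
  finally show ?case using step.IH by (rule order_trans[rotated])
qed simp

text \<open>The interiors of the exhausting sets cover the space and increase, so a finite subcover
  of a compact set lies in one member.\<close>

lemma compact_exhaustion_absorbs:
  assumes K: "compact_exhaustion m K" and C: "compactin (mtopology_of m) C"
  shows "\<exists>l\<ge>1. C \<subseteq> K l"
proof -
  \<comment> \<open>The shift by two gives \<open>K (Suc l) \<subseteq> V l\<close> for every
    natural \<open>l\<close>, although the exhaustion is indexed from 1.\<close>
  define V where "V l = mtopology_of m interior_of K (Suc (Suc l))" for l
  have KV: "K (Suc l) \<subseteq> V l" for l
    using K unfolding compact_exhaustion_def V_def by auto
  have "C \<subseteq> (\<Union>l\<in>{1..}. K l)"
    using compactin_subset_topspace[OF C] K unfolding compact_exhaustion_def by auto
  also have "\<dots> \<subseteq> (\<Union>l. V l)"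
  proof
    fix x assume "x \<in> (\<Union>l\<in>{1..}. K l)"
    then obtain l where "l \<ge> 1" "x \<in> K l" by auto
    then show "x \<in> (\<Union>l. V l)"
      using KV[of "l - 1"] by auto
  qed
  finally have "C \<subseteq> \<Union>(range V)" .
  moreover have "\<forall>U\<in>range V. openin (mtopology_of m) U" by (auto simp: V_def)
  ultimately obtain \<F> where \<F>: "finite \<F>" "\<F> \<subseteq> range V" "C \<subseteq> \<Union>\<F>"
    using C unfolding compactin_def by metis
  then obtain L where L: "finite L" "\<F> = V ` L"
    by (meson finite_subset_image)
  \<comment> \<open>\<open>insert 0\<close> keeps the maximum meaningful when the subcover is
    empty.\<close>
  define l where "l = Suc (Suc (Max (insert 0 L)))"
  have "V k \<subseteq> K l" if "k \<in> L" for k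
  proof -
    have "V k \<subseteq> K (Suc (Suc k))" by (simp add: V_def interior_of_subset)
    also have "\<dots> \<subseteq> K l"
      using L that by (intro compact_exhaustion_mono[OF K]) (auto simp: l_def)
    finally show ?thesis .
  qed
  then have "\<Union>(V ` L) \<subseteq> K l" by auto
  then have "C \<subseteq> K l" using \<F>(3) unfolding L(2) by (rule order_trans[rotated])
  moreover have "1 \<le> l" by (simp add: l_def)
  ultimately show ?thesis by blast
qed

text \<open>The preimage \<open>A n\<close> of each basic open set is sandwiched between a closed
  \<open>F n\<close> and an open \<open>V n\<close>. Off the union of the gaps
  \<open>V n - F n\<close> the sets \<open>A n\<close> and \<open>V n\<close> agree, so preimages of
  open sets are relatively open there. Removing the open gaps from a large member of the exhaustion
  leaves a compact set.\<close>

lemma Lusin: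
  assumes "finite_measure M" and sets: "sets M = sets (borel_of (mtopology_of m))"
    and K: "compact_exhaustion m K" and U: "second_countable U"
    and f: "f \<in> borel_of (mtopology_of m) \<rightarrow>\<^sub>M borel_of U" and "0 < e"
  shows "\<exists>C. compactin (mtopology_of m) C \<and> measure M (mspace m - C) < e
           \<and> continuous_map (subtopology (mtopology_of m) C) U f"
proof -
  interpret finite_measure M by fact
  let ?T = "mtopology_of m"
  have T: "metrizable_space ?T"
    using Metric_space.metrizable_space_mtopology[OF Metric_space_mspace_mdist] by (simp add: mtopology_of_def)
  have sp: "space M = mspace m"
    using sets_eq_imp_space_eq[OF sets] by simp
  obtain \<B> where \<B>: "countable_base \<B> U"
    using U by (auto simp: second_countable_iff_countable_base)
  \<comment> \<open>Adding the empty set, which is open, ensures that there is something to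
    enumerate.\<close>
  define b where "b = from_nat_into (insert {} \<B>)"
  have rb: "range b = insert {} \<B>"
    using \<B> unfolding b_def by (intro range_from_nat_into) (auto simp: countable_base_def)
  define A where "A n = f -` b n \<inter> mspace m" for n
  have bo: "openin U (b n)" for n
  proof -
    have "b n \<in> insert {} \<B>" using rb by blast
    then show ?thesis using \<B> unfolding countable_base_def by auto
  qed
  have "A n \<in> sets M" for n
    using measurable_sets[OF f open_in_sets_borel_of[OF bo[of n]]] sets by (simp add: A_def)
  then have "\<exists>F V. closedin ?T F \<and> openin ?T V \<and> F \<subseteq> A n \<and> A n \<subseteq> V
            \<and> measure M (V - F) < e / 4 * (1 / 2) ^ n" for n
    using assms T by (intro closed_open_regularity) auto
  then obtain F V where FV: "\<And>n. closedin ?T (F n)" "\<And>n. openin ?T (V n)" "\<And>n. F n \<subseteq> A n"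
      "\<And>n. A n \<subseteq> V n" "\<And>n. measure M (V n - F n) < e / 4 * (1 / 2) ^ n"
    by metis
  have Dop: "openin ?T (V n - F n)" for n using FV by (simp add: openin_diff)
  then have Dm: "V n - F n \<in> sets M" for n
    using sets by (simp add: open_in_sets_borel_of)
  have 1: "measure M (\<Union>n. V n - F n) \<le> e / 2"
    using Dm FV(5) by (intro measure_UN_geometric_le) auto
  have Kc: "compactin ?T (K (Suc l))" for l
    using K unfolding compact_exhaustion_def by auto
  have Hd: "Hausdorff_space ?T"
    using T by (rule metrizable_imp_Hausdorff_space)
  have Kcl: "closedin ?T (K (Suc l))" for l
    using Kc Hd by (simp add: compactin_imp_closedin)
  then have Km: "K (Suc l) \<in> sets M" for l
    using sets by (simp add: closed_in_sets_borel_of)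
  have "incseq (\<lambda>l. K (Suc l))"
    by (intro incseq_SucI compact_exhaustion_mono[OF K]) auto
  then have "(\<lambda>l. measure M (K (Suc l))) \<longlonglongrightarrow> measure M (\<Union>l. K (Suc l))"
    using Km by (intro finite_Lim_measure_incseq) auto
  moreover have "(\<Union>l. K (Suc l)) = space M"
  proof -
    have "{1..} = range Suc" by (auto simp: image_iff intro: exI[of _ "_ - 1"] dest: Suc_le_D)
    then have "(\<Union>l. K (Suc l)) = (\<Union>l\<in>{1..}. K l)" by auto
    then show ?thesis using K sp unfolding compact_exhaustion_def by simp
  qed
  ultimately have "\<forall>\<^sub>F l in sequentially. measure M (space M) - e / 2 < measure M (K (Suc l))"
    using \<open>0 < e\<close> by (intro order_tendstoD) auto
  then obtain l where l: "measure M (space M) - e / 2 < measure M (K (Suc l))"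
    by (auto simp: eventually_sequentially)
  have 2: "measure M (space M - K (Suc l)) < e / 2"
    using l Km sets.sets_into_space[OF Km] by (subst finite_measure_Diff) auto
  define C where "C = K (Suc l) \<inter> (\<Inter>n. mspace m - (V n - F n))"
  have "closedin ?T (\<Inter>n. mspace m - (V n - F n))"
    using Dop closedin_diff[OF closedin_topspace, of ?T] by (intro closedin_Inter) auto
  then have Cc: "compactin ?T C"
    unfolding C_def by (intro compact_Int_closedin Kc)
  have "mspace m - C \<subseteq> (\<Union>n. V n - F n) \<union> (space M - K (Suc l))"
    using sp by (auto simp: C_def)
  then have "measure M (mspace m - C) \<le> measure M ((\<Union>n. V n - F n) \<union> (space M - K (Suc l)))"
    using Dm Km by (intro finite_measure_mono) auto
  also have "\<dots> \<le> measure M (\<Union>n. V n - F n) + measure M (space M - K (Suc l))"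
    using Dm Km by (intro measure_Un_le) auto
  also have "\<dots> < e" using 1 2 by simp
  finally have 3: "measure M (mspace m - C) < e" .
  have CT: "C \<subseteq> mspace m"
    using compactin_subset_topspace[OF Cc] by simp
  have "continuous_map (subtopology ?T C) U f"
    unfolding continuous_map_alt
  proof (intro conjI allI impI)
    show "f \<in> topspace (subtopology ?T C) \<rightarrow> topspace U"
      using measurable_space[OF f] by auto
    fix G assume G: "openin U G"
    have "f -` G \<inter> topspace (subtopology ?T C) = C \<inter> (\<Union>n\<in>{n. b n \<subseteq> G}. V n)"
    proof (intro equalityI subsetI)
      fix x assume x: "x \<in> f -` G \<inter> topspace (subtopology ?T C)"
      then obtain B where "B \<in> \<B>" "f x \<in> B" "B \<subseteq> G"
        using \<B> G unfolding countable_base_def by blast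
      moreover obtain n where "B = b n" using rb \<open>B \<in> \<B>\<close> by (metis insertI2 imageE)
      ultimately show "x \<in> C \<inter> (\<Union>n\<in>{n. b n \<subseteq> G}. V n)"
        using x FV(4)[of n] by (auto simp: A_def)
    next
      fix x assume "x \<in> C \<inter> (\<Union>n\<in>{n. b n \<subseteq> G}. V n)"
      then obtain n where x: "x \<in> C" "b n \<subseteq> G" "x \<in> V n" by auto
      then have "x \<in> F n" by (auto simp: C_def)
      then show "x \<in> f -` G \<inter> topspace (subtopology ?T C)"
        using FV(3)[of n] x CT by (auto simp: A_def)
    qed
    moreover have "openin (subtopology ?T C) (C \<inter> (\<Union>n\<in>{n. b n \<subseteq> G}. V n))"
      using FV by (intro openin_subtopology_Int2) auto
    ultimately show "openin (subtopology ?T C) (f -` G \<inter> topspace (subtopology ?T C))"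
      by simp
  qed
  then show ?thesis using Cc 3 by blast
qed

section \<open>Approximation of one policy\<close>

lemma Hausdorff_space_mtopology_of: "Hausdorff_space (mtopology_of m)"
  using Metric_space.Hausdorff_space_mtopology[OF Metric_space_mspace_mdist]
  by (simp add: mtopology_of_def)

lemma compact_exhaustion_closedin:
  assumes "compact_exhaustion m K" "1 \<le> l"
  shows "closedin (mtopology_of m) (K l)"
  using assms Hausdorff_space_mtopology_of
  by (auto simp: compact_exhaustion_def intro: compactin_imp_closedin)

text \<open>The function is constant off a finite set whose points are closed by the Hausdorff
  property. Hence arbitrary choices at the points of a net yield a measurable policy.\<close>

lemma policies_finite_modification:
  assumes Z: "finite Z" "Z \<subseteq> mspace m" and h: "\<And>y. y \<in> mspace m \<Longrightarrow> h y \<in> topspace U"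
    and u: "u \<in> topspace U"
  shows "(\<lambda>y. if y \<in> Z then h y else u) \<in> policies m U"
  unfolding policies_def
proof (rule measurable_discrete_difference[where f = "\<lambda>_. u" and X = Z])
  fix z assume "z \<in> Z"
  have "closedin (mtopology_of m) {z}"
    using \<open>z \<in> Z\<close> Z by (auto simp: closedin_Hausdorff_sing_eq[OF Hausdorff_space_mtopology_of])
  then show "{z} \<in> sets (borel_of (mtopology_of m))"
    by (rule closed_in_sets_borel_of)
qed (use assms in \<open>auto intro: countable_finite\<close>)

lemma extend_quantizer_measurable:
  assumes K: "closedin (mtopology_of m) K" and q: "nearest_neighbour_map m K Z q"
    and y0: "y0 \<in> mspace m"
  shows "extend_quantizer K q y0 \<in> borel_of (mtopology_of m) \<rightarrow>\<^sub>M borel_of (mtopology_of m)"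
proof -
  have KT: "K \<subseteq> mspace m" using closedin_subset[OF K] by simp
  then have "{y \<in> space (borel_of (mtopology_of m)). y \<in> K} = K" by auto
  then have "{y \<in> space (borel_of (mtopology_of m)). y \<in> K} \<in> sets (borel_of (mtopology_of m))"
    using K by (simp add: closed_in_sets_borel_of)
  moreover have "q \<in> restrict_space (borel_of (mtopology_of m)) {y. y \<in> K} \<rightarrow>\<^sub>M borel_of (mtopology_of m)"
    using q by (simp add: nearest_neighbour_map_def)
  moreover have "(\<lambda>_. y0) \<in> restrict_space (borel_of (mtopology_of m)) {y. y \<notin> K} \<rightarrow>\<^sub>M borel_of (mtopology_of m)"
    using y0 by simp
  ultimately have "(\<lambda>y. if y \<in> K then q y else y0) \<in> borel_of (mtopology_of m) \<rightarrow>\<^sub>M borel_of (mtopology_of m)"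
    by (subst measurable_If_restrict_space_iff) auto
  then show ?thesis unfolding extend_quantizer_def[abs_def] .
qed

lemma nearest_neighbour_close:
  assumes "finite_net m K r Z" "nearest_neighbour_map m K Z q" "y \<in> K"
  shows "q y \<in> Z" "mdist m y (q y) < r"
proof -
  have am: "is_arg_min (mdist m y) (\<lambda>z. z \<in> Z) (q y)"
    using assms by (simp add: nearest_neighbour_map_def)
  then show "q y \<in> Z" by (simp add: is_arg_min_def)
  obtain z where "z \<in> Z" "mdist m y z < r"
    using assms by (auto simp: finite_net_def)
  then show "mdist m y (q y) < r"
    using am by (force simp: is_arg_min_linorder)
qed

text \<open>For \<open>y \<in> C\<close> the net point of \<open>y\<close> is within
  \<open>1 / n\<close> of \<open>y\<close>, and the selected point of \<open>C\<close> is within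
  \<open>1 / n\<close> of that net point. The selected points therefore tend to \<open>y\<close>
  inside \<open>C\<close>, where \<open>f\<close> is continuous.\<close>

lemma quantized_approximation:
  assumes K: "closedin (mtopology_of m) K" and CK: "C \<subseteq> K"
    and cont: "continuous_map (subtopology (mtopology_of m) C) U f"
    and GU: "G \<subseteq> topspace U" and fG: "f ` mspace m \<subseteq> G" and y0: "y0 \<in> mspace m"
    and net: "\<And>n. 1 \<le> n \<Longrightarrow> finite_net m K (1 / real n) (Z n)"
    and q: "\<And>n. 1 \<le> n \<Longrightarrow> nearest_neighbour_map m K (Z n) (q n)"
  shows "\<exists>g. (\<forall>n\<ge>1. g n \<in> policies m U)
           \<and> (\<forall>n. \<forall>y. g n y \<in> G)
           \<and> (\<forall>y\<in>C. limitin U (\<lambda>n. g (Suc n) (extend_quantizer K (q (Suc n)) y0 y)) (f y) sequentially)"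
proof -
  interpret Metric_space "mspace m" "mdist m" by simp
  have Km: "K \<subseteq> mspace m" using closedin_subset[OF K] by simp
  have Zm: "Z n \<subseteq> mspace m" if "1 \<le> n" for n
    using net[OF that] Km by (auto simp: finite_net_def)
  define near where "near n z p \<longleftrightarrow> p \<in> C \<and> mdist m z p < 1 / real n" for n :: nat and z p
  \<comment> \<open>A net point far from \<open>C\<close> receives the default \<open>f y0\<close>,
    which keeps all values in \<open>G\<close>; \<open>g\<close> uses the same default off the
    net.\<close>
  define h where "h n z = (if \<exists>p. near n z p then f (SOME p. near n z p) else f y0)" for n z
  define g where "g n z = (if z \<in> Z n then h n z else f y0)" for n z
  have hG: "h n z \<in> G" for n z
  proof (cases "\<exists>p. near n z p")
    case True
    then have "near n z (SOME p. near n z p)" by (rule someI_ex)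
    then have "(SOME p. near n z p) \<in> mspace m" using CK Km unfolding near_def by blast
    then show ?thesis using True fG unfolding h_def by auto
  next
    case False
    then show ?thesis using fG y0 by (auto simp: h_def)
  qed
  have f0: "f y0 \<in> G" using fG y0 by auto
  have "g n \<in> policies m U" if "1 \<le> n" for n
    unfolding g_def[abs_def] using hG f0 GU Zm[OF that] net[OF that]
    by (intro policies_finite_modification) (auto simp: finite_net_def)
  moreover have "g n y \<in> G" for n y
    using hG f0 by (auto simp: g_def)
  moreover have "limitin U (\<lambda>n. g (Suc n) (extend_quantizer K (q (Suc n)) y0 y)) (f y) sequentially"
    if y: "y \<in> C" for y
  proof -
    define p where "p n = (SOME p. near (Suc n) (q (Suc n) y) p)" for n
    have yK: "y \<in> K" using y CK by auto
    note nn = nearest_neighbour_close[OF net q yK, of "Suc _", simplified]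
    have qm: "q (Suc n) y \<in> mspace m" for n
      using nn(1)[of n] Zm[of "Suc n"] by auto
    \<comment> \<open>The point \<open>y\<close> itself is an admissible selection, so the default
      of \<open>h\<close> does not occur here.\<close>
    have ex: "near (Suc n) (q (Suc n) y) y" for n
      using nn(2)[of n] y by (simp add: near_def commute)
    then have p: "near (Suc n) (q (Suc n) y) (p n)" for n
      unfolding p_def by (rule someI)
    have pm: "p n \<in> mspace m" for n
      using p[of n] CK Km by (auto simp: near_def)
    have gp: "g (Suc n) (extend_quantizer K (q (Suc n)) y0 y) = f (p n)" for n
      using ex yK nn(1)[of n] by (auto simp: g_def h_def extend_quantizer_def p_def)
    have dist: "mdist m (p n) y < 2 / real (Suc n)" for n
    proof -
      have "mdist m (p n) y \<le> mdist m (p n) (q (Suc n) y) + mdist m (q (Suc n) y) y"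
        using pm qm yK Km by (intro triangle) auto
      moreover have "mdist m (q (Suc n) y) y < 1 / real (Suc n)"
        using nn(2)[of n] by (simp add: commute)
      moreover have "mdist m (p n) (q (Suc n) y) < 1 / real (Suc n)"
        using p[of n] by (simp add: near_def commute)
      ultimately show ?thesis by simp
    qed
    have lim: "(\<lambda>n. 2 / real (Suc n)) \<longlonglongrightarrow> 0"
      using tendsto_mult_right_zero[OF LIMSEQ_inverse_real_of_nat, of 2] by (simp add: inverse_eq_divide)
    have "(\<lambda>n. mdist m (p n) y) \<longlonglongrightarrow> 0"
    proof (rule tendsto_sandwich[OF _ _ tendsto_const lim])
      show "\<forall>\<^sub>F n in sequentially. mdist m (p n) y \<le> 2 / real (Suc n)"
        using dist by (intro always_eventually allI less_imp_le)
    qed simp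
    then have "limitin mtopology p y sequentially"
      using yK Km pm by (subst limitin_metric_dist_null) auto
    \<comment> \<open>Continuity of \<open>f\<close> is known only on the subspace \<open>C\<close>,
      so the convergence is transferred there first.\<close>
    then have "limitin (subtopology (mtopology_of m) C) p y sequentially"
      using y p by (auto simp: limitin_subtopology near_def mtopology_of_def)
    from continuous_map_limit[OF cont this] show ?thesis
      unfolding gp by (simp add: o_def)
  qed
  ultimately show ?thesis by (intro exI[of _ g]) simp
qed

section \<open>Costs of team policies\<close>

text \<open>
  The measure \<open>M\<close> plays the role of \<open>P(dx, d\<^bold>y)\<close>. Exceptional sets are not measured by \<open>M\<close>
  but by the finite measures with integrable costs as densities.
\<close>

locale team_costs =
  fixes N :: nat and X :: "'x topology" and Y :: "nat \<Rightarrow> 'y metric" and U :: "nat \<Rightarrow> 'u topology"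
    and M :: "('x \<times> (nat \<Rightarrow> 'y)) measure"
    and c :: "'x \<Rightarrow> (nat \<Rightarrow> 'y) \<Rightarrow> (nat \<Rightarrow> 'u) \<Rightarrow> real" and K :: "nat \<Rightarrow> nat \<Rightarrow> 'y set"
  assumes sets_M: "sets M = sets (borel_of X \<Otimes>\<^sub>M obs_algebra N Y)"
    and X: "second_countable X"
    and Y: "\<And>i. i \<in> {1..N} \<Longrightarrow> second_countable (mtopology_of (Y i))"
    and U: "\<And>i. i \<in> {1..N} \<Longrightarrow> second_countable (U i)"
    and K: "\<And>i. i \<in> {1..N} \<Longrightarrow> compact_exhaustion (Y i) (K i)"
    and c_measurable: "(\<lambda>(x, y, u). c x y u) \<in>
        borel_measurable (borel_of (prod_topology X (prod_topology (obs_top N Y) (act_top N U))))"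
    and c_continuous: "\<And>x. x \<in> topspace X \<Longrightarrow>
        continuous_map (prod_topology (obs_top N Y) (act_top N U)) euclideanreal (\<lambda>(y, u). c x y u)"
begin

definition cost :: "(nat \<Rightarrow> 'y \<Rightarrow> 'u) \<Rightarrow> 'x \<times> (nat \<Rightarrow> 'y) \<Rightarrow> ennreal" where
  "cost \<gamma> z = ennreal (c (fst z) (snd z) (team_action N \<gamma> (snd z)))"

definition J :: "(nat \<Rightarrow> 'y \<Rightarrow> 'u) \<Rightarrow> ennreal" where
  "J \<gamma> = (\<integral>\<^sup>+ z. cost \<gamma> z \<partial>M)"

lemma space_M: "space M = topspace X \<times> topspace (obs_top N Y)"
  by (simp add: sets_eq_imp_space_eq[OF sets_M] space_pair_measure obs_algebra_def space_PiM obs_top_def)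

lemma obs_in_mspace: "z \<in> space M \<Longrightarrow> i \<in> {1..N} \<Longrightarrow> snd z i \<in> mspace (Y i)"
  by (auto simp: space_M obs_top_def)

lemma fst_measurable: "fst \<in> M \<rightarrow>\<^sub>M borel_of X"
  using measurable_fst by (subst measurable_cong_sets[OF sets_M refl])

lemma coordinate_measurable:
  assumes "i \<in> {1..N}"
  shows "(\<lambda>z. snd z i) \<in> M \<rightarrow>\<^sub>M borel_of (mtopology_of (Y i))"
proof -
  have "snd \<in> M \<rightarrow>\<^sub>M obs_algebra N Y"
    using measurable_snd by (subst measurable_cong_sets[OF sets_M refl])
  moreover have "(\<lambda>y. y i) \<in> obs_algebra N Y \<rightarrow>\<^sub>M borel_of (mtopology_of (Y i))"
    unfolding obs_algebra_def using assms by (rule measurable_component_singleton)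
  ultimately show ?thesis by (rule measurable_compose)
qed

lemma policy_in_topspace:
  assumes "\<gamma> \<in> team_policies N Y U" "i \<in> {1..N}" "y \<in> mspace (Y i)"
  shows "\<gamma> i y \<in> topspace (U i)"
proof -
  have "\<gamma> i \<in> borel_of (mtopology_of (Y i)) \<rightarrow>\<^sub>M borel_of (U i)"
    using assms by (auto simp: team_policies_def policies_def)
  from measurable_space[OF this, of y] show ?thesis using assms(3) by simp
qed

text \<open>\<open>M\<close> carries the product of the Borel algebras, while \<open>c\<close> is
  measurable for the Borel sets of the product topology. Second countability makes the map to state,
  observations and actions measurable into the latter.\<close>

lemma cost_measurable:
  assumes \<gamma>: "\<gamma> \<in> team_policies N Y U"
  shows "cost \<gamma> \<in> borel_measurable M"
proof -
  have 1: "snd \<in> M \<rightarrow>\<^sub>M borel_of (obs_top N Y)"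
    unfolding obs_top_def
    by (rule measurable_borel_of_product)
      (use Y coordinate_measurable space_M in \<open>auto simp: obs_top_def PiE_iff\<close>)
  have 2: "(\<lambda>z. team_action N \<gamma> (snd z)) \<in> M \<rightarrow>\<^sub>M borel_of (act_top N U)"
    unfolding act_top_def
  proof (rule measurable_borel_of_product)
    fix i assume i: "i \<in> {1..N}"
    have "\<gamma> i \<in> borel_of (mtopology_of (Y i)) \<rightarrow>\<^sub>M borel_of (U i)"
      using \<gamma> i by (auto simp: team_policies_def policies_def)
    from measurable_compose[OF coordinate_measurable[OF i] this]
    show "(\<lambda>z. team_action N \<gamma> (snd z) i) \<in> M \<rightarrow>\<^sub>M borel_of (U i)"
      using i by (simp add: team_action_def)
  qed (use U in \<open>auto simp: team_action_def\<close>)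
  have Yt: "second_countable (obs_top N Y)"
    unfolding obs_top_def using Y by (intro second_countable_product_topology) auto
  have Ut: "second_countable (act_top N U)"
    unfolding act_top_def using U by (intro second_countable_product_topology) auto
  have "(\<lambda>z. (fst z, snd z, team_action N \<gamma> (snd z))) \<in>
      M \<rightarrow>\<^sub>M borel_of (prod_topology X (prod_topology (obs_top N Y) (act_top N U)))"
    by (intro measurable_borel_of_Pair fst_measurable 1 2 X Yt Ut second_countable_prod_topology)
  from measurable_compose[OF this c_measurable]
  show ?thesis unfolding cost_def[abs_def] by simp
qed

text \<open>Lusin's theorem for the image \<open>L\<close> on the \<open>i\<close>-th observation
  space of the measure with density \<open>f\<close>. Its mass off \<open>C\<close> is exactly the
  weighted integral to be bounded, and integrability of \<open>f\<close> makes it finite.\<close>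

lemma Lusin_cost:
  assumes f: "f \<in> borel_measurable M" and fin: "(\<integral>\<^sup>+ z. f z \<partial>M) < \<infinity>"
    and i: "i \<in> {1..N}" and g: "g \<in> policies (Y i) (U i)" and e: "0 < e"
  shows "\<exists>C. compactin (mtopology_of (Y i)) C
           \<and> continuous_map (subtopology (mtopology_of (Y i)) C) (U i) g
           \<and> (\<integral>\<^sup>+ z. f z * indicator (mspace (Y i) - C) (snd z i) \<partial>M) \<le> ennreal e"
proof -
  define L where "L = distr (density M f) (borel_of (mtopology_of (Y i))) (\<lambda>z. snd z i)"
  have pm: "(\<lambda>z. snd z i) \<in> density M f \<rightarrow>\<^sub>M borel_of (mtopology_of (Y i))"
    using coordinate_measurable[OF i] by simp
  have eL: "emeasure L A = (\<integral>\<^sup>+ z. f z * indicator A (snd z i) \<partial>M)"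
    if "A \<in> sets (borel_of (mtopology_of (Y i)))" for A
  proof -
    have "(\<lambda>z. snd z i) -` A \<inter> space M \<in> sets M"
      using coordinate_measurable[OF i] that by (rule measurable_sets)
    then have "emeasure L A = (\<integral>\<^sup>+ z. f z * indicator ((\<lambda>z. snd z i) -` A \<inter> space M) z \<partial>M)"
      unfolding L_def using pm that f by (simp add: emeasure_distr emeasure_density)
    also have "\<dots> = (\<integral>\<^sup>+ z. f z * indicator A (snd z i) \<partial>M)"
      by (intro nn_integral_cong) (auto simp: indicator_def)
    finally show ?thesis .
  qed
  have "finite_measure L"
  proof
    have "emeasure L (space L) \<le> (\<integral>\<^sup>+ z. f z \<partial>M)"
      using eL[OF sets.top] by (auto simp: L_def intro!: nn_integral_mono split: split_indicator)
    then show "emeasure L (space L) \<noteq> \<infinity>" using fin by (auto simp: top_unique)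
  qed
  then interpret finite_measure L .
  obtain C where C: "compactin (mtopology_of (Y i)) C" "measure L (mspace (Y i) - C) < e"
      "continuous_map (subtopology (mtopology_of (Y i)) C) (U i) g"
    using Lusin[OF \<open>finite_measure L\<close> _ K[OF i] U[OF i] _ e] g
    by (auto simp: L_def policies_def)
  have "closedin (mtopology_of (Y i)) C"
    using C(1) Hausdorff_space_mtopology_of by (rule compactin_imp_closedin[rotated])
  then have "mspace (Y i) - C \<in> sets (borel_of (mtopology_of (Y i)))"
    using sets.compl_sets[OF closed_in_sets_borel_of] by fastforce
  then have "(\<integral>\<^sup>+ z. f z * indicator (mspace (Y i) - C) (snd z i) \<partial>M) = ennreal (measure L (mspace (Y i) - C))"
    by (simp add: eL[symmetric] emeasure_eq_measure)
  also have "\<dots> \<le> ennreal e" using C by (intro ennreal_leI) simp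
  finally show ?thesis using C by blast
qed

section \<open>Replacement by policies with compact range\<close>

lemma ennreal_gap:
  assumes "x < (a::ennreal)"
  obtains e :: real where "0 < e" "x + ennreal e < a"
proof -
  \<comment> \<open>Since \<open>a\<close> may be infinite, the slack is measured up to an
    intermediate \<open>b\<close>, which is finite.\<close>
  obtain b where b: "x < b" "b < a" using assms dense by blast
  have "b < \<top>" using b(2) by (rule order.strict_trans2) simp
  then obtain s where s: "b = ennreal s" "0 \<le> s" by (cases b) auto
  have "x < \<top>" using assms by (rule order.strict_trans2) simp
  then obtain r where r: "x = ennreal r" "0 \<le> r" by (cases x) auto
  have "r < s" using b r s by (simp add: ennreal_less_iff)
  then have "x + ennreal (s - r) = b"
    using r s by (simp add: ennreal_plus[symmetric] del: ennreal_plus)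
  then show ?thesis using that[of "s - r"] \<open>r < s\<close> b by simp
qed

lemma bounded_range_replacement:
  assumes \<gamma>: "\<gamma> \<in> team_policies N Y U" and less: "J \<gamma> < a" and i: "i \<in> {1..N}"
    and u: "u \<in> topspace (U i)" and fin: "J (\<gamma>(i := \<lambda>_. u)) < \<infinity>"
  shows "\<exists>g G. g \<in> policies (Y i) (U i) \<and> compactin (U i) G \<and> g ` mspace (Y i) \<subseteq> G
           \<and> J (\<gamma>(i := g)) < a"
proof -
  let ?\<gamma>u = "\<gamma>(i := \<lambda>_. u)"
  obtain e where e: "0 < e" "J \<gamma> + ennreal e < a" using less by (rule ennreal_gap)
  have \<gamma>i: "\<gamma> i \<in> policies (Y i) (U i)"
    using \<gamma> i by (auto simp: team_policies_def)
  have \<gamma>u: "?\<gamma>u \<in> team_policies N Y U"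
    using \<gamma> u by (auto simp: team_policies_def policies_def)
  obtain C where C: "compactin (mtopology_of (Y i)) C"
      "continuous_map (subtopology (mtopology_of (Y i)) C) (U i) (\<gamma> i)"
      "(\<integral>\<^sup>+ z. cost ?\<gamma>u z * indicator (mspace (Y i) - C) (snd z i) \<partial>M) \<le> ennreal e"
    using Lusin_cost[OF cost_measurable[OF \<gamma>u] _ i \<gamma>i e(1)] fin unfolding J_def by blast
  define g where "g y = (if y \<in> C then \<gamma> i y else u)" for y
  define G where "G = insert u (\<gamma> i ` C)"
  have Cm: "C \<subseteq> mspace (Y i)" using compactin_subset_topspace[OF C(1)] by simp
  have Ccl: "closedin (mtopology_of (Y i)) C"
    using C(1) Hausdorff_space_mtopology_of by (rule compactin_imp_closedin[rotated])
  have "compactin (U i) (\<gamma> i ` C)"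
    using C(1) by (intro image_compactin[OF _ C(2)]) (simp add: compactin_subtopology)
  then have "compactin (U i) ({u} \<union> \<gamma> i ` C)"
    using u by (intro compactin_Un) auto
  then have G: "compactin (U i) G" by (simp add: G_def)
  have gG: "g ` mspace (Y i) \<subseteq> G" by (auto simp: g_def G_def)
  have g: "g \<in> policies (Y i) (U i)"
    unfolding policies_def g_def[abs_def]
  proof (rule measurable_If_set)
    show "C \<inter> space (borel_of (mtopology_of (Y i))) \<in> sets (borel_of (mtopology_of (Y i)))"
      using Cm closed_in_sets_borel_of[OF Ccl] by (simp add: Int_absorb2)
  qed (use \<gamma>i u in \<open>auto simp: policies_def\<close>)
  have "J (\<gamma>(i := g)) \<le> (\<integral>\<^sup>+ z. cost \<gamma> z + cost ?\<gamma>u z * indicator (mspace (Y i) - C) (snd z i) \<partial>M)"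
    unfolding J_def
  proof (rule nn_integral_mono)
    fix z assume z: "z \<in> space M"
    show "cost (\<gamma>(i := g)) z \<le> cost \<gamma> z + cost ?\<gamma>u z * indicator (mspace (Y i) - C) (snd z i)"
    proof (cases "snd z i \<in> C")
      case True
      then have "team_action N (\<gamma>(i := g)) (snd z) = team_action N \<gamma> (snd z)"
        by (auto simp: team_action_def g_def fun_eq_iff restrict_def)
      then show ?thesis by (simp add: cost_def)
    next
      case False
      then have "team_action N (\<gamma>(i := g)) (snd z) = team_action N ?\<gamma>u (snd z)"
        by (auto simp: team_action_def g_def fun_eq_iff restrict_def)
      then show ?thesis
        using False obs_in_mspace[OF z i] by (simp add: cost_def add_increasing)
    qed
  qed
  also have "\<dots> = J \<gamma> + (\<integral>\<^sup>+ z. cost ?\<gamma>u z * indicator (mspace (Y i) - C) (snd z i) \<partial>M)"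
  proof -
    have "mspace (Y i) - C \<in> sets (borel_of (mtopology_of (Y i)))"
      using sets.compl_sets[OF closed_in_sets_borel_of[OF Ccl]] by simp
    then have [measurable]: "(\<lambda>z. indicator (mspace (Y i) - C) (snd z i) :: ennreal) \<in> borel_measurable M"
      by (intro measurable_compose[OF coordinate_measurable[OF i]] borel_measurable_indicator)
    note [measurable] = cost_measurable[OF \<gamma>] cost_measurable[OF \<gamma>u]
    show ?thesis unfolding J_def by (rule nn_integral_add) measurable
  qed
  also have "\<dots> \<le> J \<gamma> + ennreal e" using C(3) by (rule add_left_mono)
  also have "\<dots> < a" by (rule e(2))
  finally show ?thesis using g G gG by blast
qed

text \<open>Induction on the number of agents already treated. The strict bound \<open>a\<close> is
  the invariant: each replacement spends part of the current slack, so no error budget is divided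
  among the agents beforehand.\<close>

lemma bounded_range_policies:
  assumes const: "\<And>\<gamma> i. \<gamma> \<in> team_policies N Y U \<Longrightarrow> J \<gamma> < \<infinity> \<Longrightarrow> i \<in> {1..N}
      \<Longrightarrow> \<exists>u\<in>topspace (U i). J (\<gamma>(i := \<lambda>_. u)) < \<infinity>"
    and \<gamma>: "\<gamma> \<in> team_policies N Y U" "J \<gamma> < a"
  shows "\<exists>\<gamma>'\<in>team_policies N Y U. J \<gamma>' < a
           \<and> (\<forall>i\<in>{1..N}. \<exists>G. compactin (U i) G \<and> \<gamma>' i ` mspace (Y i) \<subseteq> G)"
proof -
  have "\<exists>\<gamma>'\<in>team_policies N Y U. J \<gamma>' < a
          \<and> (\<forall>i\<in>{1..k}. \<exists>G. compactin (U i) G \<and> \<gamma>' i ` mspace (Y i) \<subseteq> G)" if "k \<le> N" for k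
    using that
  proof (induction k)
    case 0
    then show ?case using \<gamma> by auto
  next
    case (Suc k)
    then obtain \<beta> where \<beta>: "\<beta> \<in> team_policies N Y U" "J \<beta> < a"
        "\<forall>i\<in>{1..k}. \<exists>G. compactin (U i) G \<and> \<beta> i ` mspace (Y i) \<subseteq> G"
      by auto
    have i: "Suc k \<in> {1..N}" using Suc.prems by simp
    \<comment> \<open>The constant action is needed for the partly modified \<open>\<beta>\<close>;
      the invariant gives the finite cost that \<open>const\<close> asks for.\<close>
    have "J \<beta> < \<infinity>" using \<beta>(2) by (rule order.strict_trans2) simp
    then obtain u where u: "u \<in> topspace (U (Suc k))" "J (\<beta>(Suc k := \<lambda>_. u)) < \<infinity>"
      using const[OF \<beta>(1) _ i] by blast
    obtain g G where g: "g \<in> policies (Y (Suc k)) (U (Suc k))" "compactin (U (Suc k)) G"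
        "g ` mspace (Y (Suc k)) \<subseteq> G" "J (\<beta>(Suc k := g)) < a"
      using bounded_range_replacement[OF \<beta>(1,2) i u] by (elim exE conjE)
    show ?case
    proof (intro bexI[of _ "\<beta>(Suc k := g)"] conjI ballI)
      fix i assume "i \<in> {1..Suc k}"
      then consider "i = Suc k" | "i \<noteq> Suc k" "i \<in> {1..k}" by fastforce
      then show "\<exists>G. compactin (U i) G \<and> (\<beta>(Suc k := g)) i ` mspace (Y i) \<subseteq> G"
        using \<beta>(3) g by cases auto
    next
      show "\<beta>(Suc k := g) \<in> team_policies N Y U"
        using g(1) \<beta>(1) by (auto simp: team_policies_def)
    qed (rule g(4))
  qed
  then show ?thesis by blast
qed

section \<open>Quantization and dominated convergence\<close>

lemma team_action_in_topspace:
  assumes "\<gamma> \<in> team_policies N Y U" "z \<in> space M"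
  shows "team_action N \<gamma> (snd z) \<in> topspace (act_top N U)"
  using policy_in_topspace[OF assms(1)] obs_in_mspace[OF assms(2)]
  by (auto simp: act_top_def team_action_def)

lemma c_continuous_action:
  assumes x: "x \<in> topspace X" and y: "y \<in> topspace (obs_top N Y)"
  shows "continuous_map (act_top N U) euclideanreal (c x y)"
proof -
  have "continuous_map (act_top N U) (prod_topology (obs_top N Y) (act_top N U)) (\<lambda>u. (y, u))"
    using y by (simp add: continuous_map_pairwise o_def)
  from continuous_map_compose[OF this c_continuous[OF x]] show ?thesis
    by (simp add: o_def)
qed

text \<open>A real \<open>SUP\<close> bounds the members of a set only if the set is bounded above;
  continuity in the actions and compactness of \<open>G\<close> provide this.\<close>

lemma c_le_SUP:
  assumes G: "compactin (act_top N U) G" and z: "z \<in> space M" and v: "v \<in> G"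
  shows "c (fst z) (snd z) v \<le> (SUP u\<in>G. c (fst z) (snd z) u)"
proof -
  have "continuous_map (act_top N U) euclideanreal (c (fst z) (snd z))"
    using z unfolding space_M by (intro c_continuous_action) (simp_all add: mem_Times_iff)
  then have "compactin euclideanreal (c (fst z) (snd z) ` G)"
    by (rule image_compactin[OF G])
  then have "bounded (c (fst z) (snd z) ` G)"
    by (simp add: compact_imp_bounded)
  then show ?thesis
    by (intro cSUP_upper v bounded_imp_bdd_above)
qed

text \<open>State and observations stay fixed and only the actions vary. They converge
  coordinatewise, hence in the product, and \<open>c\<close> is continuous in them.\<close>

lemma cost_tendsto:
  assumes z: "z \<in> space M" and \<gamma>: "\<gamma> \<in> team_policies N Y U"
    and \<beta>: "\<And>n. \<beta> n \<in> team_policies N Y U"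
    and lim: "\<And>i. i \<in> {1..N} \<Longrightarrow> limitin (U i) (\<lambda>n. \<beta> n i (snd z i)) (\<gamma> i (snd z i)) sequentially"
  shows "(\<lambda>n. cost (\<beta> n) z) \<longlonglongrightarrow> cost \<gamma> z"
proof -
  have "limitin (act_top N U) (\<lambda>n. team_action N (\<beta> n) (snd z)) (team_action N \<gamma> (snd z)) sequentially"
    using team_action_in_topspace[OF \<beta> z] lim unfolding act_top_def limitin_componentwise
    by (auto simp: team_action_def)
  moreover have "continuous_map (act_top N U) euclideanreal (c (fst z) (snd z))"
    using z unfolding space_M by (intro c_continuous_action) (simp_all add: mem_Times_iff)
  ultimately have "(\<lambda>n. c (fst z) (snd z) (team_action N (\<beta> n) (snd z)))
      \<longlonglongrightarrow> c (fst z) (snd z) (team_action N \<gamma> (snd z))"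
    using continuous_map_limit by (fastforce simp: o_def)
  then show ?thesis
    unfolding cost_def by (rule tendsto_ennrealI)
qed

text \<open>The final cost splits into an integral over the observations in all \<open>C i\<close>,
  handled by dominated convergence, and one integral of \<open>w\<close> per agent off
  \<open>C i\<close>. The two kinds of error are bounded by \<open>e'\<close> and \<open>e\<close>,
  which together fit below \<open>a\<close>.\<close>

lemma quantized_improvement:
  assumes \<gamma>: "\<gamma> \<in> team_policies N Y U" and less: "J \<gamma> < a"
    and G: "\<And>i. i \<in> {1..N} \<Longrightarrow> compactin (U i) (G i)"
    and \<gamma>G: "\<And>i. i \<in> {1..N} \<Longrightarrow> \<gamma> i ` mspace (Y i) \<subseteq> G i"
    and int: "integrable M (\<lambda>(x, y). SUP u\<in>(\<Pi>\<^sub>E i\<in>{1..N}. G i). c x y u)"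
    and net: "\<And>i l n. i \<in> {1..N} \<Longrightarrow> 1 \<le> l \<Longrightarrow> 1 \<le> n \<Longrightarrow> finite_net (Y i) (K i l) (1 / real n) (Z i l n)"
    and q: "\<And>i l n. i \<in> {1..N} \<Longrightarrow> 1 \<le> l \<Longrightarrow> 1 \<le> n
      \<Longrightarrow> nearest_neighbour_map (Y i) (K i l) (Z i l n) (q i l n)"
    and y0: "\<And>i. i \<in> {1..N} \<Longrightarrow> y0 i \<in> mspace (Y i)"
  shows "\<exists>l\<ge>1. \<exists>n\<ge>1. \<exists>\<beta>\<in>quantized_team_policies N Y U (\<lambda>i. extend_quantizer (K i l) (q i l n) (y0 i)).
           J \<beta> < a"
proof -
  define w where "w z = ennreal (SUP u\<in>PiE {1..N} G. c (fst z) (snd z) u)" for z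
  have int': "integrable M (\<lambda>z. SUP u\<in>PiE {1..N} G. c (fst z) (snd z) u)"
    using int by (simp add: case_prod_beta')
  have wm [measurable]: "w \<in> borel_measurable M"
    unfolding w_def[abs_def] using borel_measurable_integrable[OF int'] by measurable
  have wfin: "(\<integral>\<^sup>+ z. w z \<partial>M) < \<infinity>"
    using integrableD(2)[OF int'] by (simp add: w_def less_top)
  have Gc: "compactin (act_top N U) (PiE {1..N} G)"
    unfolding act_top_def compactin_PiE using G by auto
  obtain e where e: "0 < e" "J \<gamma> + ennreal e < a" using less by (rule ennreal_gap)
  have \<gamma>i: "\<gamma> i \<in> policies (Y i) (U i)" if "i \<in> {1..N}" for i
    using \<gamma> that by (auto simp: team_policies_def)
  \<comment> \<open>The \<open>N\<close> errors of size \<open>d\<close> add up to at most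
    \<open>e\<close>, and the divisor is positive.\<close>
  define d where "d = e / real (Suc N)"
  have d: "0 < d" using e by (simp add: d_def)
  have "\<forall>i\<in>{1..N}. \<exists>C. compactin (mtopology_of (Y i)) C
           \<and> continuous_map (subtopology (mtopology_of (Y i)) C) (U i) (\<gamma> i)
           \<and> (\<integral>\<^sup>+ z. w z * indicator (mspace (Y i) - C) (snd z i) \<partial>M) \<le> ennreal d"
    using Lusin_cost[OF wm wfin _ \<gamma>i d] by (intro ballI)
  from bchoice[OF this] obtain C where C0: "\<forall>i\<in>{1..N}. compactin (mtopology_of (Y i)) (C i)
           \<and> continuous_map (subtopology (mtopology_of (Y i)) (C i)) (U i) (\<gamma> i)
           \<and> (\<integral>\<^sup>+ z. w z * indicator (mspace (Y i) - C i) (snd z i) \<partial>M) \<le> ennreal d" ..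
  then have C: "\<And>i. i \<in> {1..N} \<Longrightarrow> compactin (mtopology_of (Y i)) (C i)"
    "\<And>i. i \<in> {1..N} \<Longrightarrow> continuous_map (subtopology (mtopology_of (Y i)) (C i)) (U i) (\<gamma> i)"
    "\<And>i. i \<in> {1..N} \<Longrightarrow> (\<integral>\<^sup>+ z. w z * indicator (mspace (Y i) - C i) (snd z i) \<partial>M) \<le> ennreal d"
    by (simp_all only:)
  have "\<forall>i\<in>{1..N}. \<exists>l\<ge>1. C i \<subseteq> K i l"
    using compact_exhaustion_absorbs[OF K C(1)] by (intro ballI)
  then obtain k where k: "\<And>i. i \<in> {1..N} \<Longrightarrow> 1 \<le> k i \<and> C i \<subseteq> K i (k i)"
    by metis
  \<comment> \<open>All agents share one level \<open>l\<close>, so the maximum of the individual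
    levels is taken; \<open>insert 1\<close> also secures \<open>1 \<le> l\<close>.\<close>
  define l where "l = Max (insert 1 (k ` {1..N}))"
  have l1: "1 \<le> l" unfolding l_def by (intro Max_ge) auto
  have CK: "C i \<subseteq> K i l" if i: "i \<in> {1..N}" for i
  proof -
    have "k i \<le> l" unfolding l_def using i by (intro Max_ge) auto
    then have "K i (k i) \<subseteq> K i l"
      using k[OF i] by (intro compact_exhaustion_mono[OF K[OF i]]) auto
    then show ?thesis using k[OF i] by auto
  qed
  \<comment> \<open>From here on \<open>l\<close> is fixed and only the resolution \<open>n\<close>
    of the nets varies.\<close>
  define Q where "Q n i = extend_quantizer (K i l) (q i l n) (y0 i)" for n i
  have "\<forall>i\<in>{1..N}. \<exists>g. (\<forall>n\<ge>1. g n \<in> policies (Y i) (U i)) \<and> (\<forall>n. \<forall>y. g n y \<in> G i)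
           \<and> (\<forall>y\<in>C i. limitin (U i) (\<lambda>n. g (Suc n) (Q (Suc n) i y)) (\<gamma> i y) sequentially)"
  proof
    fix i assume i: "i \<in> {1..N}"
    show "\<exists>g. (\<forall>n\<ge>1. g n \<in> policies (Y i) (U i)) \<and> (\<forall>n. \<forall>y. g n y \<in> G i)
           \<and> (\<forall>y\<in>C i. limitin (U i) (\<lambda>n. g (Suc n) (Q (Suc n) i y)) (\<gamma> i y) sequentially)"
      unfolding Q_def
      by (rule quantized_approximation[OF compact_exhaustion_closedin[OF K[OF i] l1] CK[OF i] C(2)[OF i]
            compactin_subset_topspace[OF G[OF i]] \<gamma>G[OF i] y0[OF i] net[OF i l1] q[OF i l1]])
  qed
  from bchoice[OF this] obtain g where "\<forall>i\<in>{1..N}. (\<forall>n\<ge>1. g i n \<in> policies (Y i) (U i)) \<and> (\<forall>n. \<forall>y. g i n y \<in> G i)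
           \<and> (\<forall>y\<in>C i. limitin (U i) (\<lambda>n. g i (Suc n) (Q (Suc n) i y)) (\<gamma> i y) sequentially)" ..
  then have g: "\<And>i n. i \<in> {1..N} \<Longrightarrow> 1 \<le> n \<Longrightarrow> g i n \<in> policies (Y i) (U i)"
      "\<And>i n y. i \<in> {1..N} \<Longrightarrow> g i n y \<in> G i"
      "\<And>i y. i \<in> {1..N} \<Longrightarrow> y \<in> C i \<Longrightarrow>
          limitin (U i) (\<lambda>n. g i (Suc n) (Q (Suc n) i y)) (\<gamma> i y) sequentially"
    by (simp_all only:)
  define \<beta> where "\<beta> n i = g i (Suc n) \<circ> Q (Suc n) i" for n i
  have \<beta>q: "\<beta> n \<in> quantized_team_policies N Y U (Q (Suc n))" for n
    using g(1) by (auto simp: quantized_team_policies_def \<beta>_def)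
  have \<beta>: "\<beta> n \<in> team_policies N Y U" for n
    unfolding team_policies_def
  proof
    fix i assume i: "i \<in> {1..N}"
    have "Q (Suc n) i \<in> borel_of (mtopology_of (Y i)) \<rightarrow>\<^sub>M borel_of (mtopology_of (Y i))"
      unfolding Q_def using extend_quantizer_measurable[OF compact_exhaustion_closedin[OF K[OF i] l1] q[OF i l1] y0[OF i]]
      by simp
    then show "\<beta> n i \<in> policies (Y i) (U i)"
      using g(1)[OF i, of "Suc n"] unfolding policies_def \<beta>_def by (intro measurable_comp) auto
  qed
  have \<beta>w: "cost (\<beta> n) z \<le> w z" if z: "z \<in> space M" for n z
  proof -
    have "team_action N (\<beta> n) (snd z) \<in> PiE {1..N} G"
      using g(2) by (auto simp: team_action_def \<beta>_def)
    then show ?thesis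
      unfolding cost_def w_def by (intro ennreal_leI c_le_SUP[OF Gc z])
  qed
  \<comment> \<open>Convergence of the whole action profile is known only where every agent observes
    a point of its \<open>C i\<close>.\<close>
  define good where "good z \<longleftrightarrow> (\<forall>i\<in>{1..N}. snd z i \<in> C i)" for z :: "'x \<times> (nat \<Rightarrow> 'y)"
  have Cs: "C i \<in> sets (borel_of (mtopology_of (Y i)))" if "i \<in> {1..N}" for i
    using compactin_imp_closedin[OF Hausdorff_space_mtopology_of C(1)[OF that]]
    by (rule closed_in_sets_borel_of)
  have [measurable]: "Measurable.pred M good"
  proof -
    have "{z \<in> space M. snd z i \<in> C i} \<in> sets M" if "i \<in> {1..N}" for i
      using measurable_sets[OF coordinate_measurable[OF that] Cs[OF that]]
      by (simp add: vimage_def Int_def conj_commute)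
    then have "{z \<in> space M. \<forall>i\<in>{1..N}. snd z i \<in> C i} \<in> sets M"
      by (intro sets.sets_Collect_finite_All) auto
    then show ?thesis by (simp add: pred_def good_def)
  qed
  have bm: "(\<lambda>z. w z * indicator (mspace (Y i) - C i) (snd z i)) \<in> borel_measurable M"
    if "i \<in> {1..N}" for i
  proof -
    have "mspace (Y i) - C i \<in> sets (borel_of (mtopology_of (Y i)))"
      using sets.compl_sets[OF Cs[OF that]] by simp
    then have [measurable]: "(\<lambda>z. indicator (mspace (Y i) - C i) (snd z i) :: ennreal) \<in> borel_measurable M"
      by (intro measurable_compose[OF coordinate_measurable[OF that]] borel_measurable_indicator)
    show ?thesis by measurable
  qed
  note [measurable] = cost_measurable[OF \<gamma>] cost_measurable[OF \<beta>]
  have lim: "(\<lambda>n. \<integral>\<^sup>+ z. cost (\<beta> n) z * indicator (Collect good) z \<partial>M)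
      \<longlonglongrightarrow> (\<integral>\<^sup>+ z. cost \<gamma> z * indicator (Collect good) z \<partial>M)"
  proof (rule nn_integral_dominated_convergence[where w = w])
    fix n
    show "AE z in M. cost (\<beta> n) z * indicator (Collect good) z \<le> w z"
      using \<beta>w by (intro AE_I2) (simp split: split_indicator)
  next
    show "AE z in M. (\<lambda>n. cost (\<beta> n) z * indicator (Collect good) z)
        \<longlonglongrightarrow> cost \<gamma> z * indicator (Collect good) z"
    proof (rule AE_I2)
      fix z assume z: "z \<in> space M"
      show "(\<lambda>n. cost (\<beta> n) z * indicator (Collect good) z)
        \<longlonglongrightarrow> cost \<gamma> z * indicator (Collect good) z"
      proof (cases "good z")
        case True
        then have "(\<lambda>n. cost (\<beta> n) z) \<longlonglongrightarrow> cost \<gamma> z"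
          using g(3) by (intro cost_tendsto[OF z \<gamma> \<beta>]) (simp add: \<beta>_def good_def)
        then show ?thesis using True by simp
      qed simp
    qed
  qed (use wfin in measurable)
  have "(\<integral>\<^sup>+ z. cost \<gamma> z * indicator (Collect good) z \<partial>M) \<le> J \<gamma>"
    unfolding J_def by (intro nn_integral_mono) (simp split: split_indicator)
  \<comment> \<open>What remains after reserving \<open>e\<close> for the bad observations. As
    \<open>J \<gamma>\<close> is finite, the limit over the good set lies strictly below
    \<open>J \<gamma> + ennreal e'\<close>, which yields a suitable \<open>n\<close>.\<close>
  moreover obtain e' where e': "0 < e'" "J \<gamma> + ennreal e + ennreal e' < a"
    using e(2) by (rule ennreal_gap)
  moreover have "J \<gamma> < J \<gamma> + ennreal e'"
  proof -
    have "J \<gamma> < \<infinity>" using less by (rule order.strict_trans2) simp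
    then show ?thesis using e' by (cases "J \<gamma>") (auto simp: ennreal_less_iff simp flip: ennreal_plus)
  qed
  ultimately have "\<forall>\<^sub>F n in sequentially.
      (\<integral>\<^sup>+ z. cost (\<beta> n) z * indicator (Collect good) z \<partial>M) < J \<gamma> + ennreal e'"
    by (intro order_tendstoD(2)[OF lim]) (rule order.strict_trans1)
  then obtain n where n: "(\<integral>\<^sup>+ z. cost (\<beta> n) z * indicator (Collect good) z \<partial>M) < J \<gamma> + ennreal e'"
    by (auto simp: eventually_sequentially)
  \<comment> \<open>A bad observation misses \<open>C i\<close> for some \<open>i\<close>, and the
    \<open>i\<close>-th summand alone then dominates the cost; overlaps of the bad sets only enlarge
    the bound.\<close>
  have "J (\<beta> n) \<le> (\<integral>\<^sup>+ z. cost (\<beta> n) z * indicator (Collect good) z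
      + (\<Sum>i\<in>{1..N}. w z * indicator (mspace (Y i) - C i) (snd z i)) \<partial>M)"
    unfolding J_def
  proof (rule nn_integral_mono)
    fix z assume z: "z \<in> space M"
    show "cost (\<beta> n) z \<le> cost (\<beta> n) z * indicator (Collect good) z
      + (\<Sum>i\<in>{1..N}. w z * indicator (mspace (Y i) - C i) (snd z i))"
    proof (cases "good z")
      case True
      then show ?thesis by (simp add: add_increasing2)
    next
      case False
      then obtain i where i: "i \<in> {1..N}" "snd z i \<notin> C i" by (auto simp: good_def)
      have "cost (\<beta> n) z \<le> w z * indicator (mspace (Y i) - C i) (snd z i)"
        using \<beta>w[OF z] i obs_in_mspace[OF z i(1)] by simp
      also have "\<dots> \<le> (\<Sum>i\<in>{1..N}. w z * indicator (mspace (Y i) - C i) (snd z i))"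
        using i(1) by (intro member_le_sum) auto
      finally show ?thesis by (simp add: add_increasing)
    qed
  qed
  also have "\<dots> = (\<integral>\<^sup>+ z. cost (\<beta> n) z * indicator (Collect good) z \<partial>M)
      + (\<Sum>i\<in>{1..N}. \<integral>\<^sup>+ z. w z * indicator (mspace (Y i) - C i) (snd z i) \<partial>M)"
  proof (subst nn_integral_add)
    show "(\<lambda>z. \<Sum>i\<in>{1..N}. w z * indicator (mspace (Y i) - C i) (snd z i)) \<in> borel_measurable M"
      using bm by (rule borel_measurable_sum)
    show "(\<lambda>z. cost (\<beta> n) z * indicator (Collect good) z) \<in> borel_measurable M"
      by measurable
  qed (simp only: nn_integral_sum[OF bm])
  also have "\<dots> \<le> (J \<gamma> + ennreal e') + ennreal e"
  proof (rule add_mono)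
    have "(\<Sum>i\<in>{1..N}. \<integral>\<^sup>+ z. w z * indicator (mspace (Y i) - C i) (snd z i) \<partial>M)
        \<le> (\<Sum>i\<in>{1..N}. ennreal d)"
      using C(3) by (rule sum_mono)
    also have "\<dots> = ennreal (\<Sum>i\<in>{1..N}. d)" using d by (intro sum_ennreal) simp
    also have "\<dots> \<le> ennreal e"
      using e(1) by (intro ennreal_leI) (simp add: d_def field_simps)
    finally show "(\<Sum>i\<in>{1..N}. \<integral>\<^sup>+ z. w z * indicator (mspace (Y i) - C i) (snd z i) \<partial>M) \<le> ennreal e" .
  qed (use n in simp)
  also have "\<dots> < a" using e'(2) by (simp add: ac_simps)
  finally show ?thesis
    using \<beta>q[of n] l1 unfolding Q_def by (intro exI[of _ l] exI[of _ "Suc n"] conjI bexI) auto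
qed

end

section \<open>Assembly of the quantization theorem\<close>

lemma sets_joint_law:
  assumes "static_team N X Y U P W c"
  shows "sets (joint_law N X Y P W) = sets (borel_of X \<Otimes>\<^sub>M obs_algebra N Y)"
proof -
  \<comment> \<open>\<open>sets_bind\<close> asks for a nonempty space, which a probability measure
    has.\<close>
  interpret prob_space P using assms by (simp add: static_team_def)
  show ?thesis
    unfolding joint_law_def using not_empty by (intro sets_bind) auto
qed

theorem theorem6:
  fixes N :: nat
    and X :: "'x topology" and Y :: "nat \<Rightarrow> 'y metric" and U :: "nat \<Rightarrow> 'v::real_vector topology"
    and P :: "'x measure" and W :: "nat \<Rightarrow> 'x \<Rightarrow> 'y measure"
    and c :: "'x \<Rightarrow> (nat \<Rightarrow> 'y) \<Rightarrow> (nat \<Rightarrow> 'v) \<Rightarrow> real"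
    and K :: "nat \<Rightarrow> nat \<Rightarrow> 'y set" and Z :: "nat \<Rightarrow> nat \<Rightarrow> nat \<Rightarrow> 'y set"
    and q :: "nat \<Rightarrow> nat \<Rightarrow> nat \<Rightarrow> 'y \<Rightarrow> 'y" and y0 :: "nat \<Rightarrow> 'y"
    and \<epsilon> :: real
  assumes team: "static_team N X Y U P W c"
    and exhaustion: "\<forall>i\<in>{1..N}. compact_exhaustion (Y i) (K i)"
    and nets: "\<forall>i\<in>{1..N}. \<forall>l\<ge>1. \<forall>n\<ge>1. finite_net (Y i) (K i l) (1 / real n) (Z i l n)"
    and quantizers:
      "\<forall>i\<in>{1..N}. \<forall>l\<ge>1. \<forall>n\<ge>1. nearest_neighbour_map (Y i) (K i l) (Z i l n) (q i l n)"
    and base_points: "\<forall>i\<in>{1..N}. y0 i \<in> mspace (Y i)"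
    and a_continuous:
      "\<forall>x\<in>topspace X. continuous_map (prod_topology (obs_top N Y) (act_top N U)) euclideanreal
                          (\<lambda>(y, u). c x y u)"
    and a_bounded:
      "\<forall>C. compactin (prod_topology X (prod_topology (obs_top N Y) (act_top N U))) C
              \<longrightarrow> bounded ((\<lambda>(x, y, u). c x y u) ` C)"
    and b_closed_convex: "\<forall>i\<in>{1..N}. \<exists>V. locally_convex_vector_space V \<and> completely_metrizable_space V
              \<and> closedin V (topspace (U i)) \<and> convex (topspace (U i))
              \<and> U i = subtopology V (topspace (U i))"
    and c_locally_compact: "\<forall>i\<in>{1..N}. locally_compact_space (mtopology_of (Y i))"
    and d_integrable: "\<forall>G. compactin (act_top N U) (\<Pi>\<^sub>E i\<in>{1..N}. G i)
              \<longrightarrow> integrable (joint_law N X Y P W) (\<lambda>(x, y). SUP u\<in>(\<Pi>\<^sub>E i\<in>{1..N}. G i). c x y u)"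
    and e_constant: "\<forall>\<gamma>\<in>team_policies N Y U. team_cost N X Y P W c \<gamma> < \<infinity>
              \<longrightarrow> (\<forall>i\<in>{1..N}. \<exists>u\<in>topspace (U i). team_cost N X Y P W c (\<gamma>(i := (\<lambda>_. u))) < \<infinity>)"
    and "\<epsilon> > 0"
  shows "\<exists>l\<ge>1. \<exists>n\<ge>1. \<exists>\<gamma>\<in>quantized_team_policies N Y U (\<lambda>i. extend_quantizer (K i l) (q i l n) (y0 i)).
           team_cost N X Y P W c \<gamma> < optimal_cost N X Y U P W c + ennreal \<epsilon>"
proof -
  interpret team_costs N X Y U "joint_law N X Y P W" c K
  proof
    show "sets (joint_law N X Y P W) = sets (borel_of X \<Otimes>\<^sub>M obs_algebra N Y)"
      using team by (rule sets_joint_law)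
  qed (use team exhaustion a_continuous in
      \<open>simp_all add: static_team_def borel_space_second_countable\<close>)
  have cost: "team_cost N X Y P W c \<gamma> = J \<gamma>" for \<gamma>
    by (simp add: team_cost_def J_def cost_def case_prod_beta')
  have "\<forall>i\<in>{1..N}. \<exists>u. u \<in> topspace (U i)"
    using team by (simp add: static_team_def ex_in_conv del: null_topspace_iff_trivial)
  then obtain u where u: "\<And>i. i \<in> {1..N} \<Longrightarrow> u i \<in> topspace (U i)" by metis
  have const: "(\<lambda>i _. u i) \<in> team_policies N Y U"
    using u by (auto simp: team_policies_def policies_def)
  \<comment> \<open>The optimal cost has to be finite for \<open>ennreal \<epsilon>\<close> to leave
    a strict gap. For singletons \<open>{u i}\<close> the supremum in \<open>d_integrable\<close> is
    the cost of the constant policy, which is therefore finite.\<close>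
  have "J (\<lambda>i _. u i) < \<infinity>"
  proof -
    have "compactin (act_top N U) (\<Pi>\<^sub>E i\<in>{1..N}. {u i})"
      unfolding act_top_def compactin_PiE using u by auto
    moreover have "(\<Pi>\<^sub>E i\<in>{1..N}. {u i}) = {\<lambda>i\<in>{1..N}. u i}"
      by (simp add: PiE_eq_singleton)
    ultimately have "integrable (joint_law N X Y P W) (\<lambda>(x, y). SUP v\<in>{\<lambda>i\<in>{1..N}. u i}. c x y v)"
      using d_integrable by metis
    then have int: "integrable (joint_law N X Y P W) (\<lambda>z. c (fst z) (snd z) (\<lambda>i\<in>{1..N}. u i))"
      by (simp add: case_prod_beta')
    show ?thesis
      using integrableD(2)[OF int] by (simp add: J_def cost_def team_action_def less_top)
  qed
  then have "optimal_cost N X Y U P W c < \<infinity>"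
    unfolding optimal_cost_def cost by (intro order.strict_trans1[OF INF_lower[OF const]])
  then have "optimal_cost N X Y U P W c < optimal_cost N X Y U P W c + ennreal \<epsilon>"
    using \<open>\<epsilon> > 0\<close> by (cases "optimal_cost N X Y U P W c")
      (auto simp: ennreal_less_iff simp flip: ennreal_plus)
  then obtain \<gamma>0 where \<gamma>0: "\<gamma>0 \<in> team_policies N Y U" "J \<gamma>0 < optimal_cost N X Y U P W c + ennreal \<epsilon>"
    unfolding optimal_cost_def cost by (auto simp: INF_less_iff)
  \<comment> \<open>Both modifications preserve the strict bound
    \<open>optimal_cost N X Y U P W c + ennreal \<epsilon>\<close>, so \<epsilon> is not
    split.\<close>
  obtain \<gamma> where \<gamma>: "\<gamma> \<in> team_policies N Y U" "J \<gamma> < optimal_cost N X Y U P W c + ennreal \<epsilon>"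
      "\<forall>i\<in>{1..N}. \<exists>G. compactin (U i) G \<and> \<gamma> i ` mspace (Y i) \<subseteq> G"
    using bounded_range_policies[OF _ \<gamma>0] e_constant unfolding cost by blast
  then obtain G where G: "\<And>i. i \<in> {1..N} \<Longrightarrow> compactin (U i) (G i)"
      "\<And>i. i \<in> {1..N} \<Longrightarrow> \<gamma> i ` mspace (Y i) \<subseteq> G i"
    by metis
  have "compactin (act_top N U) (\<Pi>\<^sub>E i\<in>{1..N}. G i)"
    unfolding act_top_def compactin_PiE using G by auto
  then have int: "integrable (joint_law N X Y P W) (\<lambda>(x, y). SUP u\<in>(\<Pi>\<^sub>E i\<in>{1..N}. G i). c x y u)"
    using d_integrable by simp
  show ?thesis
    unfolding cost
    by (rule quantized_improvement[OF \<gamma>(1,2) G int, of Z q y0])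
      (use nets quantizers base_points in auto)
qed

end
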